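(* Let $\Delta H$ be a valid Hilbert function, and let $\Delta H^\star=(h_1^\star,\ldots,h_\alpha^\star)$. Suppose that $$\frac{(h_i^\star-(i-1))_+}{2}=\#\{k \mid i+1\le k\le\alpha \text{ and } h_k^\star\ge i\}\quad\text{for } i=1,\ldots,\alpha-1.$$ Then $\Delta H$ is the (first difference of the) Hilbert function of a set of double points in $\mathbb{P}^2$; that is, there is a set $Z$ of fat points in $\mathbb{P}^2$, all of which are double points, with $\Delta H_Z=\Delta H$.
   Context: Let $k$ be an algebraically closed field of characteristic zero, $\mathbb{P}^2=\mathbb{P}^2_k$ and $R=k[x_0,x_1,x_2]$ with the standard grading. For distinct points $P_1,\ldots,P_s\in\mathbb{P}^2$ with homogeneous ideals $I_{P_i}$ and positive integers $m_i$, the set of fat points $Z=m_1P_1+\cdots+m_sP_s$ is the scheme defined by $I_Z=I_{P_1}^{m_1}\cap\cdots\cap I_{P_s}^{m_s}$; a point with $m_i=2$ is a double point of $Z$. The Hilbert function of $Z$ is $H_Z(i)=\dim_k(R/I_Z)_i$, and its first difference is $\Delta H_Z(i)=H_Z(i)-H_Z(i-1)$ with $H_Z(-1)=0$; writing $\Delta H_Z=(h_0,\ldots,h_\sigma)$ means $\Delta H_Z(i)=h_i$ for $0\le i\le\sigma$ and $\Delta H_Z(i)=0$ for $i>\sigma$. A valid Hilbert function is a finite sequence of positive integers $\Delta H=(h_0,\ldots,h_\sigma)$, $\sigma\ge1$, for which there is an integer $\alpha$ with $1\le\alpha\le\sigma+1$ such that $h_i=i+1$ for $0\le i<\alpha$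 and $\alpha\ge h_\alpha\ge h_{\alpha+1}\ge\cdots\ge h_\sigma$. Its conjugate is $\Delta H^\star=(h_1^\star,\ldots,h_\alpha^\star)$ with $h_i^\star=\#\{j\mid h_j\ge i\}$. For an integer $n$, $n_+=\max\{n,0\}$.
   Formalization: The formal theorem also assumes α ≥ 2; for α = 1, i.e. ΔH = (1,…,1), the condition is vacuous and the claim fails (e.g. ΔH = (1,1) has sum 2, not a multiple of 3; no set of double points has H(1) = 2). *)

theory Defs
  imports
    "HOL-Library.Poly_Mapping"
    "HOL-Library.Multiset"
    "HOL-Library.Numeral_Type"
    "HOL-Computational_Algebra.Computational_Algebra"
    "HOL-Analysis.Cartesian_Space"
    "HOL-Algebra.Algebra"
    "HOL-Algebra.Algebraic_Closure_Type"
begin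

section \<open>The homogeneous coordinate ring of the projective plane\<close>

text \<open>Polynomials in three variables: finitely supported functions from exponent vectors to
  coefficients, with convolution as multiplication.\<close>

type_synonym 'k poly3 = "(3 \<Rightarrow>\<^sub>0 nat) \<Rightarrow>\<^sub>0 'k"

abbreviation coord_ring :: "('k::field) poly3 ring" where
  "coord_ring \<equiv> ring_of_type_algebra"

definition const3 :: "'k::field \<Rightarrow> 'k poly3" where
  "const3 c = Poly_Mapping.single 0 c"

definition eval3 :: "'k::field poly3 \<Rightarrow> 'k ^ 3 \<Rightarrow> 'k" where
  "eval3 f v = (\<Sum>e\<in>Poly_Mapping.keys f.
     Poly_Mapping.lookup f e * (\<Prod>j\<in>UNIV. (v $ j) ^ Poly_Mapping.lookup e j))"

definition forms :: "nat \<Rightarrow> 'k::field poly3 set" where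
  "forms d = {f. \<forall>e\<in>Poly_Mapping.keys f. (\<Sum>j\<in>UNIV. Poly_Mapping.lookup e j) = d}"

section \<open>Fat points and their Hilbert functions\<close>

text \<open>A point of the plane is a line through the origin of the three-dimensional vector space.\<close>

definition proj_plane :: "('k::field ^ 3) set set" where
  "proj_plane = {P. vec.subspace P \<and> vec.dim P = 1}"

definition point_ideal :: "('k::field ^ 3) set \<Rightarrow> 'k poly3 set" where
  "point_ideal P = Idl\<^bsub>coord_ring\<^esub> {f. (\<exists>d. f \<in> forms d) \<and> (\<forall>v\<in>P. eval3 f v = 0)}"

text \<open>A set of fat points \<open>m\<^sub>1P\<^sub>1 + \<dots> + m\<^sub>sP\<^sub>s\<close> is represented by the multiset in which \<open>P\<^sub>i\<close> occurs
  \<open>m\<^sub>i\<close> times.\<close>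

definition is_fat_points :: "('k::field ^ 3) set multiset \<Rightarrow> bool" where
  "is_fat_points Z \<longleftrightarrow> set_mset Z \<subseteq> proj_plane"

definition all_double :: "('k::field ^ 3) set multiset \<Rightarrow> bool" where
  "all_double Z \<longleftrightarrow> (\<forall>P\<in>#Z. count Z P = 2)"

definition fat_ideal :: "('k::field ^ 3) set multiset \<Rightarrow> 'k poly3 set" where
  "fat_ideal Z = (\<Inter>P\<in>set_mset Z. point_ideal P [^]\<^bsub>ideals_set coord_ring\<^esub> count Z P)"

text \<open>The dimension over the field of constants of the image of the forms of degree \<open>i\<close> in the
  quotient ring.\<close>

definition hilbert_fun :: "('k::field ^ 3) set multiset \<Rightarrow> nat \<Rightarrow> nat" where
  "hilbert_fun Z i =
     ring.dim (coord_ring Quot fat_ideal Z)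
       (range (\<lambda>c. fat_ideal Z +>\<^bsub>coord_ring\<^esub> const3 c))
       ((\<lambda>f. fat_ideal Z +>\<^bsub>coord_ring\<^esub> f) ` forms i)"

definition diff_hilbert_fun :: "('k::field ^ 3) set multiset \<Rightarrow> nat \<Rightarrow> int" where
  "diff_hilbert_fun Z i =
     int (hilbert_fun Z i) - (if i = 0 then 0 else int (hilbert_fun Z (i - 1)))"

section \<open>Valid Hilbert functions\<close>

text \<open>The sequence \<open>(h\<^sub>0, \<dots>, h\<^sub>\<sigma>)\<close> is a list of length \<open>\<sigma> + 1\<close>. The number \<open>\<alpha>\<close> is determined by
  the list; it is a parameter because the conjugate has length \<open>\<alpha>\<close>. The case \<open>\<alpha> = 1\<close>, the sequences
  \<open>(1, \<dots>, 1)\<close>, is included here, but no such sequence is the first difference of the Hilbert function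
  of a set of double points: no nonzero linear form vanishes doubly at a point.\<close>

definition valid_hilbert_fun :: "nat list \<Rightarrow> nat \<Rightarrow> bool" where
  "valid_hilbert_fun h \<alpha> \<longleftrightarrow>
     2 \<le> length h \<and> (\<forall>i<length h. 0 < h ! i) \<and>
     1 \<le> \<alpha> \<and> \<alpha> \<le> length h \<and>
     (\<forall>i<\<alpha>. h ! i = i + 1) \<and>
     (\<forall>i. \<alpha> \<le> i \<and> i < length h \<longrightarrow> h ! i \<le> \<alpha>) \<and>
     (\<forall>i j. \<alpha> \<le> i \<and> i \<le> j \<and> j < length h \<longrightarrow> h ! j \<le> h ! i)"

definition conjugate :: "nat list \<Rightarrow> nat \<Rightarrow> nat" where
  "conjugate h i = card {j. j < length h \<and> i \<le> h ! j}"

end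

theory Submission imports Defs begin

text \<open>
  Let \<open>d\<^sub>i\<close> be the \<open>i\<close>-th entry of the conjugate. Since \<open>h\<close> starts with \<open>1, 2, \<dots>, \<alpha>\<close> and does not
  increase afterwards, the positions with \<open>h\<^sub>t \<ge> i\<close> are exactly \<open>i - 1 \<le> t < i - 1 + d\<^sub>i\<close>, and
  \<open>d\<^sub>1 > \<dots> > d\<^sub>\<alpha>\<close>.

  Take lines \<open>L\<^sub>1, \<dots>, L\<^sub>\<alpha>\<close>, no three of them concurrent, and let \<open>Z\<close> consist of the double points at
  \<open>L\<^sub>j \<inter> L\<^sub>k\<close> for those pairs \<open>j < k\<close> with \<open>j \<le> d\<^sub>k\<close>. Remove the lines one after the other, starting
  with \<open>L\<^sub>1\<close>; removing a line lowers the multiplicity of each point on it by one. When its turn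
  comes, \<open>L\<^sub>i\<close> carries the points \<open>L\<^sub>i \<inter> L\<^sub>k\<close> with \<open>k > i\<close>, still double, and the points
  \<open>L\<^sub>j \<inter> L\<^sub>i\<close> with \<open>j < i\<close>, now simple. The hypothesis says that for \<open>i < \<alpha>\<close> the double points
  contribute \<open>(d\<^sub>i - (i - 1))\<^sub>+\<close>; the simple points contribute \<open>min (i - 1) d\<^sub>i\<close>, so what is left of
  \<open>Z\<close> meets \<open>L\<^sub>i\<close> in degree \<open>d\<^sub>i\<close>. For \<open>i = \<alpha>\<close> this needs \<open>d\<^sub>\<alpha> \<le> \<alpha> - 1\<close>, which the
  hypothesis for \<open>i = \<alpha> - 1\<close> forces: at most one double point is left on \<open>L\<^bsub>\<alpha>-1\<^esub>\<close>.

  Let \<open>W\<^sub>i(t)\<close> be the forms of degree \<open>t\<close> vanishing on what is left of \<open>Z\<close> after the removal of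
  \<open>L\<^sub>1, \<dots>, L\<^sub>i\<close>. Its codimension in all forms is \<open>\<Sum>\<^bsub>j>i\<^esub> min (t + 2 + i - j)\<^sub>+ d\<^sub>j\<close>. This goes by
  induction from \<open>i = \<alpha>\<close> down to \<open>i = 0\<close>, with two bounds.

  \<^item> At least (\<open>independent_forms_mod_residual\<close>): restricted to \<open>L\<^bsub>i+1\<^esub>\<close>, the forms of \<open>W\<^sub>i(t)\<close>
    become multiples of one polynomial of degree \<open>d\<^bsub>i+1\<^esub>\<close> in the parameter \<open>T\<close>, so forms that
    restrict to \<open>1, T, T\<^sup>2, \<dots>\<close> below that degree are independent modulo \<open>W\<^sub>i(t)\<close>. They stay so
    together with the multiples by \<open>L\<^bsub>i+1\<^esub>\<close> of forms independent modulo \<open>W\<^bsub>i+1\<^esub>(t - 1)\<close>, because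
    \<open>L\<^bsub>i+1\<^esub> g\<close> is in \<open>W\<^sub>i(t)\<close> exactly if \<open>g\<close> is in \<open>W\<^bsub>i+1\<^esub>(t - 1)\<close>.
  \<^item> At most (\<open>codim_le_forms_residual\<close>): \<open>W\<^sub>i(t)\<close> is cut out of \<open>W\<^bsub>i+1\<^esub>(t)\<close> by \<open>d\<^bsub>i+1\<^esub>\<close>
    linear conditions, and it contains \<open>L\<^bsub>i+1\<^esub> W\<^bsub>i+1\<^esub>(t - 1)\<close>, where the multiples of
    \<open>L\<^bsub>i+1\<^esub>\<close> have codimension \<open>t + 1\<close>. The first estimate is used if \<open>d\<^bsub>i+1\<^esub> \<le> t + 1\<close>, the second
    otherwise; they reach the wanted number because the \<open>d\<^sub>j\<close> decrease strictly.

  For \<open>i = 0\<close> the number is \<open>H\<^sub>Z(t)\<close>, and its difference at \<open>t\<close> counts the \<open>j\<close> with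
  \<open>j - 1 \<le> t < j - 1 + d\<^sub>j\<close>, which is \<open>h\<^sub>t\<close>.

  Two translations connect this with ideals: a form lies in the square of the ideal of a point
  exactly if it vanishes there to order two (\<open>point_ideal_sq_iff\<close>), and lists of forms that are
  independent and spanning modulo the ideal determine the dimension in the quotient ring
  (\<open>hilbert_fun_eqI\<close>).
\<close>

section \<open>Forms in three variables\<close>

definition var3 :: "3 \<Rightarrow> 'k::field poly3" where
  "var3 j = Poly_Mapping.single (Poly_Mapping.single j 1) 1"

lemma const3_add: "const3 (a + b) = const3 a + const3 b"
  by (simp add: const3_def single_add)

lemma const3_mult: "const3 (a * b) = const3 a * const3 b"
  by (simp add: const3_def mult_single)

lemma const3_1 [simp]: "const3 1 = 1"
  by (simp add: const3_def)

lemma const3_0 [simp]: "const3 0 = 0"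
  by (simp add: const3_def)

lemma const3_minus: "const3 (- a) = - const3 a"
  by (simp add: const3_def single_uminus)

interpretation P3: vector_space "\<lambda>(c::'k::field) (f::'k poly3). const3 c * f"
  by unfold_locales (simp_all add: const3_add const3_mult algebra_simps)

lemma poly3_induct [case_names single add]:
  assumes single: "\<And>e c. P (Poly_Mapping.single e c)"
    and add: "\<And>f g. P f \<Longrightarrow> P g \<Longrightarrow> P (f + g)"
  shows "P (f :: 'k::field poly3)"
proof -
  have *: "f = (\<Sum>e\<in>Poly_Mapping.keys f. Poly_Mapping.single e (Poly_Mapping.lookup f e))"
    by (rule poly_mapping_eqI)
       (simp add: lookup_sum lookup_single when_def in_keys_iff)
  have "P (\<Sum>e\<in>A. Poly_Mapping.single e (Poly_Mapping.lookup f e))" if "finite A" for A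
    using that
  proof induction
    case empty
    show ?case using single[of 0 0] by simp
  qed (simp add: single add)
  then show ?thesis using * by (metis finite_keys)
qed

lemma forms_subspace: "P3.subspace (forms t)"
proof (rule P3.subspaceI)
  show "0 \<in> forms t" by (simp add: forms_def)
next
  fix f g :: "'a poly3" assume "f \<in> forms t" "g \<in> forms t"
  then show "f + g \<in> forms t"
    using Poly_Mapping.keys_add[of f g] by (auto simp: forms_def)
next
  fix c and f :: "'a poly3" assume "f \<in> forms t"
  then show "const3 c * f \<in> forms t"
    using Poly_Mapping.keys_mult[of "const3 c" f]
    by (fastforce simp: forms_def const3_def split: if_splits)
qed

lemma single_in_forms: "(\<Sum>j\<in>UNIV. Poly_Mapping.lookup e j) = t \<Longrightarrow> Poly_Mapping.single e c \<in> forms t"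
  by (simp add: forms_def)

lemma forms_mult:
  assumes "f \<in> forms s" "g \<in> forms t"
  shows "f * g \<in> forms (s + t)"
proof -
  have "(\<Sum>j\<in>UNIV. Poly_Mapping.lookup e j) = s + t" if e: "e \<in> Poly_Mapping.keys (f * g)" for e
  proof -
    obtain a b where "a \<in> Poly_Mapping.keys f" "b \<in> Poly_Mapping.keys g" "e = a + b"
      using e Poly_Mapping.keys_mult[of f g] by blast
    then show ?thesis using assms by (simp add: forms_def lookup_add sum.distrib)
  qed
  then show ?thesis by (simp add: forms_def)
qed

lemma const3_in_forms: "const3 c \<in> forms 0"
  unfolding const3_def by (rule single_in_forms) simp

lemma one_in_forms: "1 \<in> forms 0"
  using const3_in_forms[of 1] by simp

lemma var3_in_forms: "var3 j \<in> forms 1"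
  unfolding var3_def by (rule single_in_forms) (simp add: lookup_single when_def)

lemma forms_power: "f \<in> forms s \<Longrightarrow> f ^ n \<in> forms (n * s)"
  by (induction n) (auto intro: forms_mult one_in_forms)

lemma forms_0_eq: "forms 0 = range const3"
proof -
  have "f \<in> range const3" if "f \<in> forms 0" for f :: "'a poly3"
  proof -
    have e: "e = 0" if "e \<in> Poly_Mapping.keys f" for e
      using that \<open>f \<in> forms 0\<close> by (auto simp: forms_def intro!: poly_mapping_eqI)
    have "f = const3 (Poly_Mapping.lookup f 0)"
      unfolding const3_def
      by (rule poly_mapping_eqI) (metis e lookup_single_eq lookup_single_not_eq in_keys_iff)
    then show ?thesis by blast
  qed
  then show ?thesis by (auto simp: const3_in_forms)
qed

text \<open>A form is a sum of terms of the same degree, and a term of positive degree is a variable times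
  another term; so a family of additive properties, one for each degree, only has to be transported
  along multiplication by variables.\<close>

lemma forms_induct [consumes 1, case_names const var add]:
  assumes "f \<in> forms t"
    and const: "\<And>c. P 0 (const3 c)"
    and var: "\<And>t j f. f \<in> forms t \<Longrightarrow> P t f \<Longrightarrow> P (Suc t) (var3 j * f)"
    and add: "\<And>t f g. P t f \<Longrightarrow> P t g \<Longrightarrow> P t (f + g)"
  shows "P t f"
proof -
  have single: "P t (Poly_Mapping.single e c)" if "(\<Sum>j\<in>UNIV. Poly_Mapping.lookup e j) = t" for e c t
    using that
  proof (induction t arbitrary: e)
    case 0
    then have "e = 0" by (auto intro!: poly_mapping_eqI)
    then show ?case using const[of c] by (simp add: const3_def)
  next
    case (Suc t)
    then obtain j where j: "Poly_Mapping.lookup e j \<noteq> 0" by force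
    define e' where "e' = e - Poly_Mapping.single j 1"
    have e: "e = Poly_Mapping.single j 1 + e'"
      by (rule poly_mapping_eqI) (use j in \<open>auto simp: e'_def lookup_minus lookup_add lookup_single when_def\<close>)
    have "(\<Sum>i\<in>UNIV. Poly_Mapping.lookup e' i) = t"
      using Suc.prems unfolding e by (simp add: lookup_add sum.distrib lookup_single when_def)
    then have "P (Suc t) (var3 j * Poly_Mapping.single e' c)"
      using Suc.IH by (intro var single_in_forms)
    then show ?case by (simp add: var3_def mult_single e)
  qed
  have *: "f = (\<Sum>e\<in>Poly_Mapping.keys f. Poly_Mapping.single e (Poly_Mapping.lookup f e))"
    by (rule poly_mapping_eqI)
       (simp add: lookup_sum lookup_single when_def in_keys_iff)
  have P0: "P t 0"
    using single[of "Poly_Mapping.single 1 t" t 0] by (simp add: lookup_single when_def)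
  have "P t (\<Sum>e\<in>A. Poly_Mapping.single e (Poly_Mapping.lookup f e))"
    if "A \<subseteq> Poly_Mapping.keys f" for A
    using finite_subset[OF that finite_keys] that
  proof (induction A)
    case (insert e A)
    have "P t (Poly_Mapping.single e (Poly_Mapping.lookup f e))"
      by (rule single) (use insert.prems \<open>f \<in> forms t\<close> in \<open>auto simp: forms_def\<close>)
    then show ?case using insert by (simp add: add)
  qed (simp add: P0)
  then show ?thesis using * by (metis order_refl)
qed

section \<open>Restriction to lines and order of vanishing\<close>

text \<open>The polynomial \<open>f(v + T w)\<close> in the parameter \<open>T\<close>. As a ring homomorphism it replaces both
  evaluation and differentiation: its constant coefficient is the value at \<open>v\<close>, its linear
  coefficient the derivative at \<open>v\<close> in the direction \<open>w\<close>.\<close>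

definition restr :: "'k::field ^ 3 \<Rightarrow> 'k ^ 3 \<Rightarrow> 'k poly3 \<Rightarrow> 'k poly" where
  "restr v w f = (\<Sum>e\<in>Poly_Mapping.keys f.
     smult (Poly_Mapping.lookup f e) (\<Prod>j\<in>UNIV. [:v $ j, w $ j:] ^ Poly_Mapping.lookup e j))"

lemma restr_single:
  "restr v w (Poly_Mapping.single e c) = smult c (\<Prod>j\<in>UNIV. [:v $ j, w $ j:] ^ Poly_Mapping.lookup e j)"
  by (simp add: restr_def)

lemma restr_add: "restr v w (f + g) = restr v w f + restr v w g"
  unfolding restr_def by (rule setsum_keys_plus_distrib) (simp_all add: smult_add_left)

lemma restr_0 [simp]: "restr v w 0 = 0"
  by (simp add: restr_def)

lemma restr_mult: "restr v w (f * g) = restr v w f * restr v w g"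
proof (induction f rule: poly3_induct)
  case (single e c)
  show ?case
    by (induction g rule: poly3_induct)
       (simp_all add: restr_add restr_single mult_single lookup_add power_add prod.distrib
         distrib_left distrib_right smult_add_right ac_simps)
qed (simp add: restr_add distrib_right)

lemma restr_const3 [simp]: "restr v w (const3 c) = [:c:]"
  by (simp add: const3_def restr_single)

lemma restr_1 [simp]: "restr v w 1 = 1"
  using restr_const3[of v w 1] by (simp add: one_pCons)

lemma restr_var3 [simp]: "restr v w (var3 j) = [:v $ j, w $ j:]"
proof -
  have "(\<Prod>i\<in>UNIV. [:v $ i, w $ i:] ^ Poly_Mapping.lookup (Poly_Mapping.single j (1::nat)) i)
      = (\<Prod>i\<in>UNIV. if i = j then [:v $ i, w $ i:] else 1)"
    by (rule prod.cong) (auto simp: lookup_single when_def)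
  then show ?thesis by (simp add: var3_def restr_single)
qed

lemma restr_power: "restr v w (f ^ n) = restr v w f ^ n"
  by (induction n) (simp_all add: restr_mult)

lemma restr_diff: "restr v w (f - g) = restr v w f - restr v w g"
  by (metis add_diff_cancel_right' diff_add_cancel restr_add)

lemma restr_minus: "restr v w (- f) = - restr v w f"
  using restr_diff[of v w 0 f] by simp

lemma eval3_eq_restr: fixes v w :: "'k::field ^ 3" shows "eval3 f v = poly (restr v w f) 0"
  by (simp add: eval3_def restr_def poly_sum poly_prod poly_power)

lemma pcompose_power: "pcompose (p ^ n) q = pcompose p q ^ n" for p :: "'a::comm_ring_1 poly"
  by (induction n) (simp_all add: pcompose_mult pcompose_1)

text \<open>Moving the base point along the line is a translation of the parameter.\<close>

lemma restr_shift: "restr (v + s *s b) b f = pcompose (restr v b f) [:s, 1:]"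
proof (induction f rule: poly3_induct)
  case (single e c)
  have "[:v $ j + s * b $ j, b $ j:] = pcompose [:v $ j, b $ j:] [:s, 1:]" for j
    by (simp add: pcompose_pCons)
  then show ?case
    by (simp add: restr_single pcompose_smult pcompose_prod pcompose_power)
qed (simp add: restr_add pcompose_add)

definition vanishes_to :: "nat \<Rightarrow> 'k::field ^ 3 \<Rightarrow> 'k poly3 \<Rightarrow> bool" where
  "vanishes_to m v f \<longleftrightarrow> (\<forall>w. [:0, 1:] ^ m dvd restr v w f)"

lemma vanishes_to_0 [simp]: "vanishes_to 0 v f"
  by (simp add: vanishes_to_def)

lemma vanishes_to_add: "vanishes_to m v f \<Longrightarrow> vanishes_to m v g \<Longrightarrow> vanishes_to m v (f + g)"
  by (simp add: vanishes_to_def restr_add)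

lemma vanishes_to_mult: "vanishes_to m v f \<Longrightarrow> vanishes_to n v g \<Longrightarrow> vanishes_to (m + n) v (f * g)"
  by (simp add: vanishes_to_def restr_mult power_add mult_dvd_mono)

lemma vanishes_to_mono: "vanishes_to m v f \<Longrightarrow> n \<le> m \<Longrightarrow> vanishes_to n v f"
  unfolding vanishes_to_def by (meson dvd_trans le_imp_power_dvd)

lemma vanishes_to_1_iff: "vanishes_to 1 v f \<longleftrightarrow> eval3 f v = 0"
  unfolding vanishes_to_def power_one_right
  by (simp add: eval3_eq_restr[of f v, where w = 0] flip: poly_eq_0_iff_dvd[of _ 0, simplified])
     (metis eval3_eq_restr)

text \<open>Turns a point of the line with parameter \<open>s\<close> into a root \<open>s\<close> of the restriction, with the right
  multiplicity.\<close>

lemma vanishes_to_imp_power_dvd_restr: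
  assumes "vanishes_to m (v + s *s b) f"
  shows "[:- s, 1:] ^ m dvd restr v b f"
proof -
  have "[:0, 1:] ^ m dvd pcompose (restr v b f) [:s, 1:]"
    using assms by (auto simp: vanishes_to_def restr_shift[symmetric])
  then obtain q where "pcompose (restr v b f) [:s, 1:] = [:0, 1:] ^ m * q" ..
  then have "pcompose (pcompose (restr v b f) [:s, 1:]) [:-s, 1:] = pcompose ([:0, 1:] ^ m * q) [:-s, 1:]"
    by simp
  then have "restr v b f = [:- s, 1:] ^ m * pcompose q [:-s, 1:]"
    by (simp flip: pcompose_assoc add: pcompose_mult pcompose_power pcompose_pCons)
  then show ?thesis by simp
qed

section \<open>Forms that vanish doubly at a point\<close>

text \<open>For a point \<open>v\<close> with last coordinate \<open>1\<close>, the linear forms with indices \<open>1\<close> and \<open>2\<close> are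
  homogeneous local coordinates at \<open>v\<close>; they generate its ideal.\<close>

definition local_coord :: "3 \<Rightarrow> 'k::field ^ 3 \<Rightarrow> 'k poly3" where
  "local_coord j v = var3 j - const3 (v $ j) * var3 3"

lemma local_coord_in_forms: "local_coord j v \<in> forms 1"
  unfolding local_coord_def
  by (intro P3.subspace_diff[OF forms_subspace] P3.subspace_scale[OF forms_subspace] var3_in_forms)

lemma restr_local_coord:
  fixes v :: "'k::field ^ 3"
  shows "v $ 3 = 1 \<Longrightarrow> restr v w (local_coord j v) = [:0, w $ j - v $ j * w $ 3:]"
  by (simp add: local_coord_def restr_diff restr_mult)

lemma vanishes_local_coord:
  fixes v :: "'k::field ^ 3"
  shows "v $ 3 = 1 \<Longrightarrow> vanishes_to 1 v (local_coord j v)"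
  unfolding vanishes_to_1_iff using eval3_eq_restr[of "local_coord j v" v 0]
  by (simp add: restr_local_coord)

text \<open>The Taylor expansion at \<open>v\<close>, homogenised by the third variable and cut after the linear terms,
  with a remainder in the square of the ideal of \<open>v\<close>. Multiplication by a variable, itself a
  combination of \<open>x\<close>, \<open>y\<close> and the third variable, preserves this shape. In degree \<open>0\<close> the exponent
  \<open>t - 1\<close> is truncated, and the linear terms have to be absent.\<close>

lemma Taylor_form:
  fixes f :: "'k::field poly3" and v :: "'k ^ 3"
  defines "x \<equiv> local_coord 1 v" and "y \<equiv> local_coord 2 v"
  assumes "f \<in> forms t"
  shows "\<exists>A B C a b c. (t = 0 \<longrightarrow> B = 0 \<and> C = 0) \<and>
    f = const3 A * var3 3 ^ t + (const3 B * x + const3 C * y) * var3 3 ^ (t - 1)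
      + (a * (x * x) + b * (x * y) + c * (y * y))"
  using assms(3)
proof (induction rule: forms_induct)
  case (const c)
  show ?case by (rule exI[of _ c], intro exI[of _ 0]) simp
next
  case (var t j f)
  let ?z = "var3 3 :: 'k poly3"
  obtain A B C a b c where t0: "t = 0 \<longrightarrow> B = 0 \<and> C = 0" and
    f: "f = const3 A * ?z ^ t + (const3 B * x + const3 C * y) * ?z ^ (t - 1)
      + (a * (x * x) + b * (x * y) + c * (y * y))"
    using var.IH by blast
  have z: "?z * ((const3 B * x + const3 C * y) * ?z ^ (t - 1)) = (const3 B * x + const3 C * y) * ?z ^ t"
    using t0 by (cases t) (auto simp: algebra_simps)
  obtain p q s where "var3 j = const3 p * x + const3 q * y + const3 s * ?z"
  proof -
    have "j = 1 \<or> j = 2 \<or> j = 3" by (rule exhaust_3)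
    moreover have "var3 1 = const3 1 * x + const3 0 * y + const3 (v $ 1) * ?z"
      by (simp add: x_def local_coord_def)
    moreover have "var3 2 = const3 0 * x + const3 1 * y + const3 (v $ 2) * ?z"
      by (simp add: y_def local_coord_def)
    moreover have "var3 3 = const3 0 * x + const3 0 * y + const3 1 * ?z"
      by simp
    ultimately show thesis using that by metis
  qed
  note vj = this
  define Z Y where "Z = ?z ^ t" and "Y = ?z ^ (t - 1)"
  define r where "r = a * (x * x) + b * (x * y) + c * (y * y)"
  have "var3 j * f = (const3 p * x + const3 q * y) * (const3 A * Z + (const3 B * x + const3 C * y) * Y + r)
      + const3 s * (const3 A * (?z * Z) + ?z * ((const3 B * x + const3 C * y) * Y) + ?z * r)"
    unfolding f vj Z_def[symmetric] Y_def[symmetric] r_def[symmetric] 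
    by (simp only: distrib_left distrib_right mult.assoc mult.commute mult.left_commute
        add.assoc add.commute add.left_commute)
  also have "?z * ((const3 B * x + const3 C * y) * Y) = (const3 B * x + const3 C * y) * Z"
    using z by (simp add: Z_def Y_def)
  also have "?z * Z = ?z ^ Suc t" by (simp add: Z_def)
  also have "(const3 p * x + const3 q * y) * (const3 A * Z + (const3 B * x + const3 C * y) * Y + r)
      + const3 s * (const3 A * ?z ^ Suc t + (const3 B * x + const3 C * y) * Z + ?z * r)
    = const3 (s * A) * ?z ^ Suc t +
      (const3 (p * A + s * B) * x + const3 (q * A + s * C) * y) * Z +
     ((const3 p * (const3 B * Y + a * x + b * y) + const3 s * ?z * a) * (x * x)
     + (const3 p * (const3 C * Y + c * y) + const3 q * (const3 B * Y + a * x)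
         + const3 s * ?z * b) * (x * y)
     + (const3 q * (const3 C * Y + b * x + c * y) + const3 s * ?z * c) * (y * y))"
    unfolding r_def const3_add const3_mult
    by (simp only: distrib_left distrib_right mult.assoc mult.commute mult.left_commute
        add.assoc add.commute add.left_commute)
  finally have eq: "var3 j * f = const3 (s * A) * ?z ^ Suc t +
      (const3 (p * A + s * B) * x + const3 (q * A + s * C) * y) * ?z ^ (Suc t - 1) +
     ((const3 p * (const3 B * Y + a * x + b * y) + const3 s * ?z * a) * (x * x)
     + (const3 p * (const3 C * Y + c * y) + const3 q * (const3 B * Y + a * x)
         + const3 s * ?z * b) * (x * y)
     + (const3 q * (const3 C * Y + b * x + c * y) + const3 s * ?z * c) * (y * y))"
    by (simp only: Z_def diff_Suc_1)
  show ?case by (intro exI, rule conjI[rotated], rule eq) simp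
next
  case (add t f g)
  obtain A B C a b c where t0: "t = 0 \<longrightarrow> B = 0 \<and> C = 0" and
    f: "f = const3 A * var3 3 ^ t + (const3 B * x + const3 C * y) * var3 3 ^ (t - 1)
      + (a * (x * x) + b * (x * y) + c * (y * y))"
    using add by blast
  obtain A' B' C' a' b' c' where t0': "t = 0 \<longrightarrow> B' = 0 \<and> C' = 0" and
    g: "g = const3 A' * var3 3 ^ t + (const3 B' * x + const3 C' * y) * var3 3 ^ (t - 1)
      + (a' * (x * x) + b' * (x * y) + c' * (y * y))"
    using add by blast
  have eq: "f + g = const3 (A + A') * var3 3 ^ t + (const3 (B + B') * x + const3 (C + C') * y) * var3 3 ^ (t - 1)
      + ((a + a') * (x * x) + (b + b') * (x * y) + (c + c') * (y * y))"
    unfolding f g const3_add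
    by (simp only: distrib_left distrib_right mult.assoc mult.commute mult.left_commute
        add.assoc add.commute add.left_commute)
  show ?case by (intro exI, rule conjI[rotated], rule eq) (use t0 t0' in simp)
qed

text \<open>The three coefficients of the expansion are the value and the derivatives in the first two
  directions, so all that remains is the remainder.\<close>

lemma doubly_vanishing_form:
  fixes f :: "'k::field poly3" and v :: "'k ^ 3"
  assumes "f \<in> forms t" and v: "v $ 3 = 1" and "eval3 f v = 0"
    and "coeff (restr v (axis 1 1) f) 1 = 0" "coeff (restr v (axis 2 1) f) 1 = 0"
  obtains a b c where "f = a * (local_coord 1 v * local_coord 1 v)
    + b * (local_coord 1 v * local_coord 2 v) + c * (local_coord 2 v * local_coord 2 v)"
proof -
  let ?x = "local_coord 1 v" and ?y = "local_coord 2 v" and ?z = "var3 3 :: 'k poly3"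
  obtain A B C a b c where 
    f: "f = const3 A * ?z ^ t + (const3 B * ?x + const3 C * ?y) * ?z ^ (t - 1)
      + (a * (?x * ?x) + b * (?x * ?y) + c * (?y * ?y))"
    using Taylor_form[OF assms(1), of v] by blast
  have 1: "restr v (axis 1 1) f = [:A, B:] + [:0, 1:] * ([:0, 1:] * restr v (axis 1 1) a)"
    unfolding f by (simp add: restr_add restr_mult restr_power restr_local_coord v one_pCons[symmetric] axis_def)
  have 2: "restr v (axis 2 1) f = [:A, C:] + [:0, 1:] * ([:0, 1:] * restr v (axis 2 1) c)"
    unfolding f by (simp add: restr_add restr_mult restr_power restr_local_coord v one_pCons[symmetric] axis_def)
  have "A = 0" using assms(3) eval3_eq_restr[of f v "axis 1 1"] 1 by simp
  moreover have "B = 0" using assms(4) 1 by simp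
  moreover have "C = 0" using assms(5) 2 by simp
  ultimately show thesis using that f by simp
qed

text \<open>Double vanishing at a point amounts to three linear conditions; if the form is known to vanish
  there, two are left.\<close>

lemma vanishes_to_2_iff:
  fixes v :: "'k::field ^ 3"
  assumes "f \<in> forms t" and v: "v $ 3 = 1"
  shows "vanishes_to 2 v f \<longleftrightarrow> eval3 f v = 0 \<and>
    coeff (restr v (axis 1 1) f) 1 = 0 \<and> coeff (restr v (axis 2 1) f) 1 = 0"
proof
  assume f: "vanishes_to 2 v f"
  have "coeff (restr v w f) 1 = 0" for w
  proof -
    obtain q where "restr v w f = [:0, 1:] ^ 2 * q" using f by (auto simp: vanishes_to_def)
    then show ?thesis by (simp add: power2_eq_square)
  qed
  moreover have "eval3 f v = 0"
    using f vanishes_to_mono[of 2 v f 1] by (simp flip: vanishes_to_1_iff)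
  ultimately show "eval3 f v = 0 \<and>
    coeff (restr v (axis 1 1) f) 1 = 0 \<and> coeff (restr v (axis 2 1) f) 1 = 0" by simp
next
  assume "eval3 f v = 0 \<and>
    coeff (restr v (axis 1 1) f) 1 = 0 \<and> coeff (restr v (axis 2 1) f) 1 = 0"
  then obtain a b c where f: "f = a * (local_coord 1 v * local_coord 1 v)
    + b * (local_coord 1 v * local_coord 2 v) + c * (local_coord 2 v * local_coord 2 v)"
    using doubly_vanishing_form[OF assms] by metis
  have "vanishes_to 2 v (g * (local_coord i v * local_coord j v))" for g i j
    using vanishes_to_mult[OF vanishes_to_0[of v g] vanishes_to_mult[OF vanishes_local_coord[OF v] vanishes_local_coord[OF v]]]
    by (simp add: numeral_2_eq_2)
  then show "vanishes_to 2 v f" unfolding f by (intro vanishes_to_add)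
qed

section \<open>Ideals of double points\<close>

lemma coord_ring_simps [simp]:
  "carrier coord_ring = UNIV" "a \<otimes>\<^bsub>coord_ring\<^esub> b = a * b" "a \<oplus>\<^bsub>coord_ring\<^esub> b = a + b"
  "\<one>\<^bsub>coord_ring\<^esub> = 1" "\<zero>\<^bsub>coord_ring\<^esub> = 0"
  by (simp_all add: ring_of_type_algebra_def)

lemma cring_coord: "cring (coord_ring :: 'k::field poly3 ring)"
  by (rule cring_from_type_algebra)

interpretation CR: cring "coord_ring :: 'k::field poly3 ring"
  by (rule cring_coord)

lemma ideal_coord_iff:
  "ideal I (coord_ring :: 'k::field poly3 ring) \<longleftrightarrow>
     0 \<in> I \<and> (\<forall>f\<in>I. \<forall>g\<in>I. f + g \<in> I) \<and> (\<forall>f. \<forall>g\<in>I. f * g \<in> I)"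
proof
  assume I: "ideal I (coord_ring :: 'k poly3 ring)"
  interpret ideal I "coord_ring :: 'k poly3 ring" by (rule I)
  show "0 \<in> I \<and> (\<forall>f\<in>I. \<forall>g\<in>I. f + g \<in> I) \<and> (\<forall>f. \<forall>g\<in>I. f * g \<in> I)"
    using zero_closed a_closed I_l_closed by simp
next
  assume *: "0 \<in> I \<and> (\<forall>f\<in>I. \<forall>g\<in>I. f + g \<in> I) \<and> (\<forall>f. \<forall>g\<in>I. f * g \<in> I)"
  have m: "- f \<in> I" if "f \<in> I" for f using * that by (metis mult_minus1)
  have inv: "inv\<^bsub>add_monoid coord_ring\<^esub> f = - f" for f :: "'k poly3"
    using CR.minus_equality[of "- f" f] by (simp add: a_inv_def)
  show "ideal I coord_ring"
  proof (rule idealI)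
    show "subgroup I (add_monoid coord_ring)"
      by (rule group.subgroupI[OF CR.a_group]) (use * m inv in auto)
  next
    fix f g :: "'k poly3" assume "f \<in> I"
    then have "g * f \<in> I" using * by blast
    then show "g \<otimes>\<^bsub>coord_ring\<^esub> f \<in> I" "f \<otimes>\<^bsub>coord_ring\<^esub> g \<in> I" by (simp_all add: mult.commute)
  qed (rule CR.ring_axioms)
qed

lemma ideal_point_ideal: "ideal (point_ideal P) coord_ring"
  unfolding point_ideal_def by (rule CR.genideal_ideal) simp

lemma eval3_scale:
  assumes "f \<in> forms t" shows "eval3 f (c *s v) = c ^ t * eval3 f v"
  using assms
proof (induction rule: forms_induct)
  case (var t j f)
  have "eval3 (var3 j * f) u = u $ j * eval3 f u" for u
    by (simp add: eval3_eq_restr[of _ u 0] restr_mult)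
  then show ?case using var by simp
qed (auto simp: eval3_eq_restr[of _ _ 0] restr_add algebra_simps)

lemma local_coord_in_point_ideal:
  fixes v :: "'k::field ^ 3"
  assumes "v $ 3 = 1" shows "local_coord j v \<in> point_ideal (vec.span {v})"
proof -
  have "eval3 (local_coord j v) u = 0" if u: "u \<in> vec.span {v}" for u
  proof -
    obtain c where "u = c *s v" using u by (auto simp: vec.span_singleton)
    then show ?thesis
      using eval3_scale[OF local_coord_in_forms, of j v c v] vanishes_local_coord[OF assms, of j]
      by (simp flip: vanishes_to_1_iff)
  qed
  then show ?thesis
    unfolding point_ideal_def
    by (intro subsetD[OF CR.genideal_self]) (use local_coord_in_forms in auto)
qed

lemma point_ideal_vanishes:
  assumes "f \<in> point_ideal P" "v \<in> P" shows "vanishes_to 1 v f"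
proof -
  have "ideal {f. vanishes_to 1 v f} coord_ring"
    unfolding ideal_coord_iff
    by (simp add: vanishes_to_def restr_add restr_mult)
  then have "point_ideal P \<subseteq> {f. vanishes_to 1 v f}"
    unfolding point_ideal_def
    by (rule CR.genideal_minimal) (use \<open>v \<in> P\<close> in \<open>auto simp del: One_nat_def simp: vanishes_to_1_iff\<close>)
  then show ?thesis using assms by auto
qed

lemma ideals_set_power_2:
  assumes "ideal I (coord_ring :: 'k::field poly3 ring)"
  shows "I [^]\<^bsub>ideals_set coord_ring\<^esub> (2::nat) = ideal_prod coord_ring I I"
proof -
  have "f \<in> I" if "f \<in> ideal_prod coord_ring UNIV I" for f
    using that assms unfolding ideal_coord_iff by induction auto
  moreover have "f \<in> ideal_prod coord_ring UNIV I" if "f \<in> I" for f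
    using ideal_prod.prod[of 1 UNIV f I "coord_ring :: 'k poly3 ring"] that by simp
  ultimately have "ideal_prod coord_ring UNIV I = I" by blast
  then show ?thesis
    by (simp add: numeral_2_eq_2 nat_pow_def ideals_set_def)
qed

lemma ideal_point_ideal_sq: "ideal (point_ideal P [^]\<^bsub>ideals_set coord_ring\<^esub> (2::nat)) coord_ring"
  by (simp add: ideals_set_power_2 ideal_point_ideal CR.ideal_prod_is_ideal)

text \<open>Elements of the square are sums of products of two forms vanishing at the point; conversely the
  remainder of the Taylor expansion is visibly in the square.\<close>

lemma point_ideal_sq_iff:
  fixes v :: "'k::field ^ 3"
  assumes "f \<in> forms t" and v: "v $ 3 = 1"
  shows "f \<in> point_ideal (vec.span {v}) [^]\<^bsub>ideals_set coord_ring\<^esub> (2::nat) \<longleftrightarrow> vanishes_to 2 v f"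
proof
  let ?I = "point_ideal (vec.span {v})"
  assume "f \<in> ?I [^]\<^bsub>ideals_set coord_ring\<^esub> (2::nat)"
  then have "f \<in> ideal_prod coord_ring ?I ?I"
    by (simp add: ideals_set_power_2 ideal_point_ideal)
  then show "vanishes_to 2 v f"
  proof induction
    case (prod i j)
    then show ?case
      using vanishes_to_mult[of 1 v i 1 j] point_ideal_vanishes[of _ "vec.span {v}" v] vec.span_base[of v "{v}"]
      by (simp add: numeral_2_eq_2)
  qed (auto intro: vanishes_to_add)
next
  let ?I = "point_ideal (vec.span {v})"
  assume "vanishes_to 2 v f"
  then obtain a b c where f: "f = a * (local_coord 1 v * local_coord 1 v)
    + b * (local_coord 1 v * local_coord 2 v) + c * (local_coord 2 v * local_coord 2 v)"
    using doubly_vanishing_form[OF assms] vanishes_to_2_iff[OF assms] by metis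
  have "local_coord i v * local_coord j v \<in> ideal_prod coord_ring ?I ?I" for i j
    using ideal_prod.prod[OF local_coord_in_point_ideal[OF v] local_coord_in_point_ideal[OF v], where R = "coord_ring"] by simp
  moreover have "ideal (ideal_prod coord_ring ?I ?I) coord_ring"
    by (simp add: ideal_point_ideal CR.ideal_prod_is_ideal)
  ultimately have "f \<in> ideal_prod coord_ring ?I ?I"
    unfolding f ideal_coord_iff by blast
  then show "f \<in> ?I [^]\<^bsub>ideals_set coord_ring\<^esub> (2::nat)"
    by (simp add: ideals_set_power_2 ideal_point_ideal)
qed

lemma span_in_proj_plane: "v \<noteq> 0 \<Longrightarrow> vec.span {v} \<in> proj_plane"
  by (simp add: proj_plane_def vec.subspace_span)

definition double_points :: "('k::field ^ 3) set \<Rightarrow> ('k ^ 3) set multiset" where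
  "double_points V = repeat_mset 2 (mset_set ((\<lambda>v. vec.span {v}) ` V))"

lemma count_double_points:
  "finite V \<Longrightarrow> count (double_points V) P = (if P \<in> (\<lambda>v. vec.span {v}) ` V then 2 else 0)"
  by (simp add: double_points_def)

lemma set_mset_double_points: "finite V \<Longrightarrow> set_mset (double_points V) = (\<lambda>v. vec.span {v}) ` V"
  unfolding set_mset_def by (auto simp: count_double_points)

lemma fat_ideal_double_points:
  assumes "finite V"
  shows "fat_ideal (double_points V)
       = (\<Inter>v\<in>V. point_ideal (vec.span {v}) [^]\<^bsub>ideals_set coord_ring\<^esub> (2::nat))"
  unfolding fat_ideal_def set_mset_double_points[OF assms] using assms
  by (simp add: count_double_points)

lemma ideal_fat_ideal:
  assumes "finite V"
  shows "ideal (fat_ideal (double_points V)) coord_ring"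
proof -
  let ?J = "\<lambda>v. point_ideal (vec.span {v}) [^]\<^bsub>ideals_set coord_ring\<^esub> (2::nat)"
  have J: "0 \<in> ?J v" "f \<in> ?J v \<Longrightarrow> g \<in> ?J v \<Longrightarrow> f + g \<in> ?J v" "g \<in> ?J v \<Longrightarrow> f * g \<in> ?J v"
    for f g and v :: "'a ^ 3"
    using ideal_point_ideal_sq[of "vec.span {v}"] unfolding ideal_coord_iff by simp_all
  show ?thesis
    unfolding fat_ideal_double_points[OF assms] ideal_coord_iff
    by (auto intro: J)
qed

lemma form_in_fat_ideal_iff:
  fixes V :: "('k::field ^ 3) set"
  assumes "finite V" "\<And>v. v \<in> V \<Longrightarrow> v $ 3 = 1" "f \<in> forms t"
  shows "f \<in> fat_ideal (double_points V) \<longleftrightarrow> (\<forall>v\<in>V. vanishes_to 2 v f)"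
  unfolding fat_ideal_double_points[OF assms(1)] using assms(2) point_ideal_sq_iff[OF assms(3)] by simp

section \<open>Dimensions modulo a subspace\<close>

text \<open>The list is built from its end: each entry is outside the span of \<open>W\<close> and the entries after it.
  This is also how \<open>ring.independent\<close> is built up, and it lets a list be extended at the front by
  forms of another kind.\<close>

fun indep_mod :: "'k::field poly3 set \<Rightarrow> 'k poly3 list \<Rightarrow> bool" where
  "indep_mod W [] \<longleftrightarrow> True"
| "indep_mod W (u # us) \<longleftrightarrow> u \<notin> P3.span (W \<union> set us) \<and> indep_mod W us"

definition codim_le :: "'k::field poly3 set \<Rightarrow> 'k poly3 set \<Rightarrow> nat \<Rightarrow> bool" where
  "codim_le V W n \<longleftrightarrow> (\<exists>S. finite S \<and> card S \<le> n \<and> V \<subseteq> P3.span (W \<union> S))"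

lemma codim_le_trans:
  assumes "codim_le V U m" "codim_le U W n"
  shows "codim_le V W (m + n)"
proof -
  obtain S T where S: "finite S" "card S \<le> m" "V \<subseteq> P3.span (U \<union> S)"
    and T: "finite T" "card T \<le> n" "U \<subseteq> P3.span (W \<union> T)"
    using assms unfolding codim_le_def by blast
  have "P3.span (U \<union> S) \<subseteq> P3.span (W \<union> (S \<union> T))"
    using T(3) P3.span_mono[of "W \<union> T" "W \<union> (S \<union> T)"] P3.span_superset[of "W \<union> (S \<union> T)"]
    by (intro P3.span_minimal P3.subspace_span) blast
  moreover have "card (S \<union> T) \<le> m + n" using card_Un_le[of S T] S T by linarith
  ultimately show ?thesis unfolding codim_le_def using S T by (meson finite_UnI order_trans)
qed

lemma codim_le_mult:
  assumes "codim_le V W n"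
  shows "codim_le ((*) l ` V) ((*) l ` W) n"
proof -
  obtain S where S: "finite S" "card S \<le> n" "V \<subseteq> P3.span (W \<union> S)"
    using assms unfolding codim_le_def by blast
  have "(*) l ` P3.span (W \<union> S) \<subseteq> P3.span ((*) l ` (W \<union> S))"
  proof clarify
    fix f assume "f \<in> P3.span (W \<union> S)"
    then show "l * f \<in> P3.span ((*) l ` (W \<union> S))"
    proof (induction rule: P3.span_induct_alt)
      case (step c x y)
      then have "l * x \<in> P3.span ((*) l ` (W \<union> S))" by (intro P3.span_base) blast
      then have "const3 c * (l * x) + l * y \<in> P3.span ((*) l ` (W \<union> S))"
        using step by (intro P3.span_add P3.span_scale)
      then show ?case by (simp only: distrib_left mult.left_commute[of l])
    qed (simp add: P3.span_zero)
  qed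
  then have "(*) l ` V \<subseteq> P3.span ((*) l ` W \<union> (*) l ` S)" using S(3) by (auto simp: image_Un)
  moreover have "card ((*) l ` S) \<le> n" using S card_image_le order_trans by blast
  ultimately show ?thesis unfolding codim_le_def using S(1) by blast
qed

lemma codim_le_kernel:
  assumes V: "P3.subspace V"
    and add: "\<And>f g. \<phi> (f + g) = \<phi> f + \<phi> g" and scale: "\<And>c f. \<phi> (const3 c * f) = c * \<phi> f"
  shows "codim_le V {f\<in>V. \<phi> f = (0::'k::field)} 1"
proof (cases "\<exists>u\<in>V. \<phi> u \<noteq> 0")
  case False
  then show ?thesis unfolding codim_le_def
    by (intro exI[of _ "{}"]) (auto intro: P3.span_base)
next
  case True
  then obtain u where u: "u \<in> V" "\<phi> u \<noteq> 0" by blast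
  let ?W = "{f\<in>V. \<phi> f = 0}"
  have "f \<in> P3.span (?W \<union> {u})" if "f \<in> V" for f
  proof -
    define c where "c = \<phi> f / \<phi> u"
    have "\<phi> (f + const3 (- c) * u) = 0" using u unfolding add scale by (simp add: c_def)
    moreover have "f + const3 (- c) * u \<in> V"
      using V that u(1) by (intro P3.subspace_add P3.subspace_scale)
    ultimately have "f + const3 (- c) * u \<in> ?W" by simp
    then have "(f + const3 (- c) * u) + const3 c * u \<in> P3.span (?W \<union> {u})"
      by (intro P3.span_add P3.span_scale P3.span_base) auto
    then show ?thesis by (simp only: const3_minus minus_mult_left[symmetric] add.assoc left_minus add_0_right)
  qed
  then show ?thesis unfolding codim_le_def by (intro exI[of _ "{u}"]) auto
qed

text \<open>A system of \<open>n\<close> homogeneous linear equations cuts down the dimension by at most \<open>n\<close>.\<close>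

lemma codim_le_kernels:
  assumes "finite I" and V: "P3.subspace V"
    and add: "\<And>i f g. i \<in> I \<Longrightarrow> \<phi> i (f + g) = \<phi> i f + \<phi> i g"
    and scale: "\<And>i c f. i \<in> I \<Longrightarrow> \<phi> i (const3 c * f) = c * \<phi> i f"
  shows "codim_le V {f\<in>V. \<forall>i\<in>I. \<phi> i f = (0::'k::field)} (card I)"
  using assms(1,3,4)
proof (induction I)
  case empty
  show ?case unfolding codim_le_def by (auto intro!: exI[of _ "{}"] P3.span_base)
next
  case (insert i I)
  let ?U = "{f\<in>V. \<forall>i\<in>I. \<phi> i f = 0}"
  have z: "\<phi> j 0 = 0" if "j \<in> insert i I" for j using insert.prems(2)[OF that, of 0 0] by simp
  have "P3.subspace ?U"
    using V insert.prems z unfolding P3.subspace_def by simp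
  then have "codim_le ?U {f\<in>?U. \<phi> i f = 0} 1"
    using insert.prems by (intro codim_le_kernel) auto
  moreover have "codim_le V ?U (card I)" using insert by auto
  ultimately have "codim_le V {f\<in>?U. \<phi> i f = 0} (card I + 1)" by (rule codim_le_trans[rotated])
  moreover have "{f\<in>?U. \<phi> i f = 0} = {f\<in>V. \<forall>i\<in>insert i I. \<phi> i f = 0}" by auto
  ultimately show ?case using insert by simp
qed

lemma (in ring) Span_absorb:
  assumes "subfield K R" "set us \<subseteq> carrier R" "u \<in> Span K us"
  shows "Span K (u # us) = Span K us"
proof
  have "u \<in> carrier R"
    using assms Span_in_carrier[OF subringE(1)[OF subfieldE(1)[OF assms(1)]] assms(2)] by blast
  then show "Span K us \<subseteq> Span K (u # us)" by (rule mono_Span[OF assms(1,2)])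
  show "Span K (u # us) \<subseteq> Span K us"
    using assms(2,3) Span_base_incl[OF assms(1,2)]
    by (intro mono_Span_subset[OF assms(1)]) (simp_all del: Span.simps)
qed

lemma (in ring) dimension_Span_le:
  assumes "subfield K R" "set us \<subseteq> carrier R"
  shows "\<exists>m\<le>length us. dimension m K (Span K us)"
  using assms(2)
proof (induction us)
  case (Cons u us)
  then obtain m where m: "m \<le> length us" "dimension m K (Span K us)" by auto
  show ?case
  proof (cases "u \<in> Span K us")
    case True
    then show ?thesis using m Span_absorb[OF assms(1) _ True] Cons.prems by (intro exI[of _ m]) auto
  next
    case False
    then show ?thesis using m Suc_dim[of u "Span K us" m K] Cons.prems by (intro exI[of _ "Suc m"]) auto
  qed
qed auto

text \<open>An independent list in \<open>E\<close> that is at least as long as a list spanning \<open>E\<close> is a basis.\<close>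

lemma (in ring) dim_eqI:
  assumes K: "subfield K R" and us: "independent K us" "Span K us \<subseteq> E"
    and vs: "set vs \<subseteq> carrier R" "E \<subseteq> Span K vs" "length vs \<le> length us"
  shows "dim K E = length us"
proof -
  obtain m where m: "m \<le> length vs" "dimension m K (Span K vs)"
    using dimension_Span_le[OF K vs(1)] by blast
  have sub: "set us \<subseteq> Span K vs"
    using Span_base_incl[OF K independent_in_carrier[OF us(1)]] us(2) vs(2) by blast
  have "length us = m"
    using independent_length_le_dimension[OF K m(2) us(1) sub] m(1) vs(3) by simp
  then have "Span K us = Span K vs"
    using independent_length_eq_dimension[OF K m(2) us(1) sub] by simp
  then have "E = Span K us" using us(2) vs(2) by blast
  then have "dimension (length us) K E" using us(1) by (simp only: dimension_independent)
  then show ?thesis unfolding dim_def using dimension_is_inj[OF K] by blast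
qed

lemma subfield_const3: "subfield (range const3) (coord_ring :: 'k::field poly3 ring)"
proof -
  let ?F = "ring_of_type_algebra :: 'k ring"
  interpret F: Ring.field ?F by (rule field_from_type_algebra)
  interpret h: ring_hom_ring ?F "coord_ring :: 'k poly3 ring" const3
    by (intro ring_hom_ringI2 F.ring_axioms CR.ring_axioms ring_hom_memI)
       (auto simp: ring_of_type_algebra_def const3_add const3_mult)
  have "subfield (carrier ?F) ?F" by (rule F.carrier_is_subfield)
  then have "subfield (const3 ` carrier ?F) (coord_ring :: 'k poly3 ring)"
    by (rule h.img_is_subfield(2)) simp
  then show ?thesis by (simp add: ring_of_type_algebra_def)
qed

text \<open>Independent and spanning lists modulo \<open>I \<inter> forms t\<close> map to independent and spanning lists in the
  quotient ring over the image of the constants. That image is a field because \<open>I\<close> is proper.\<close>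

lemma hilbert_fun_eqI:
  fixes Z :: "('k::field ^ 3) set multiset"
  defines "I \<equiv> fat_ideal Z"
  assumes I: "ideal I coord_ring" and one: "1 \<notin> I"
    and us: "set us \<subseteq> forms t" "indep_mod (I \<inter> forms t) us"
    and codim: "codim_le (forms t) (I \<inter> forms t) (length us)"
  shows "hilbert_fun Z t = length us"
proof -
  let ?R = "coord_ring :: 'k poly3 ring"
  let ?Q = "?R Quot I" and ?p = "\<lambda>f. I +>\<^bsub>?R\<^esub> f"
  interpret I: ideal I ?R by (rule I)
  interpret Q: ring ?Q by (rule I.quotient_is_ring)
  interpret p: ring_hom_ring ?R ?Q ?p by (rule I.rcos_ring_hom_ring)
  have I': "0 \<in> I" "\<And>f g. f \<in> I \<Longrightarrow> g \<in> I \<Longrightarrow> f + g \<in> I" "\<And>f g. g \<in> I \<Longrightarrow> f * g \<in> I"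
    using I unfolding ideal_coord_iff by auto
  have coset: "?p f = (\<lambda>h. h + f) ` I" for f
    by (auto simp: a_r_coset_def r_coset_def)
  have p_eq_imp: "f - g \<in> I" if "?p f = ?p g" for f g
  proof -
    have "f \<in> ?p f" using I'(1) unfolding coset by force
    then show ?thesis unfolding that by (auto simp: coset)
  qed
  have p_zero: "?p f = \<zero>\<^bsub>?Q\<^esub>" if "f \<in> I" for f
    using that by (simp add: FactRing_def I.a_rcos_const)
  have p_add: "?p (f + g) = ?p f \<oplus>\<^bsub>?Q\<^esub> ?p g" for f g using p.hom_add[of f g] by simp
  have p_mult: "?p (f * g) = ?p f \<otimes>\<^bsub>?Q\<^esub> ?p g" for f g using p.hom_mult[of f g] by simp
  have p_carr: "?p f \<in> carrier ?Q" for f using p.hom_closed by simp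
  define K where "K = range (\<lambda>c. ?p (const3 c))"
  have K: "subfield K ?Q"
  proof -
    have "\<one>\<^bsub>?Q\<^esub> \<noteq> \<zero>\<^bsub>?Q\<^esub>"
    proof
      assume "\<one>\<^bsub>?Q\<^esub> = \<zero>\<^bsub>?Q\<^esub>"
      then have "?p 1 = ?p 0" using p.hom_one p.hom_zero by simp
      then have "1 - 0 \<in> I" by (rule p_eq_imp)
      then show False using one by simp
    qed
    then have "subfield (?p ` range const3) ?Q"
      by (rule p.img_is_subfield(2)[OF subfield_const3])
    then show ?thesis by (simp add: K_def image_image)
  qed
  have Span_sub: "ring.Span ?Q K (map ?p fs) \<subseteq> ?p ` P3.span (set fs)" for fs
  proof (induction fs)
    case Nil
    then show ?case using p_zero[OF I'(1)] by (auto simp: P3.span_zero)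
  next
    case (Cons f fs)
    show ?case
    proof
      fix u assume "u \<in> ring.Span ?Q K (map ?p (f # fs))"
      then obtain c g where u: "u = ?p (const3 c) \<otimes>\<^bsub>?Q\<^esub> ?p f \<oplus>\<^bsub>?Q\<^esub> ?p g" and g: "g \<in> P3.span (set fs)"
        using Cons.IH by (auto simp: Q.line_extension_mem_iff K_def)
      have "u = ?p (const3 c * f + g)" unfolding u p_add p_mult ..
      moreover have "const3 c * f + g \<in> P3.span (set (f # fs))"
      proof (rule P3.span_add)
        show "const3 c * f \<in> P3.span (set (f # fs))" by (intro P3.span_scale P3.span_base) simp
        show "g \<in> P3.span (set (f # fs))" using g P3.span_mono[of "set fs" "set (f # fs)"] by auto
      qed
      ultimately show "u \<in> ?p ` P3.span (set (f # fs))" by blast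
    qed
  qed
  have indep: "ring.independent ?Q K (map ?p us)" using us
  proof (induction us)
    case (Cons u us)
    have "?p u \<notin> ring.Span ?Q K (map ?p us)"
    proof
      assume "?p u \<in> ring.Span ?Q K (map ?p us)"
      then obtain g where g: "g \<in> P3.span (set us)" "?p u = ?p g" using Span_sub by blast
      have "P3.span (set us) \<subseteq> forms t" using Cons.prems by (intro P3.span_minimal forms_subspace) auto
      then have "u - g \<in> I \<inter> forms t"
        using g p_eq_imp Cons.prems by (auto intro: P3.subspace_diff[OF forms_subspace])
      then have "(u - g) + g \<in> P3.span ((I \<inter> forms t) \<union> set us)"
        using g P3.span_mono[of "set us" "(I \<inter> forms t) \<union> set us"]
        by (intro P3.span_add) (auto intro: P3.span_base)
      then show False using Cons.prems by simp
    qed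
    then show ?case using Cons p_carr by (auto intro: Q.li_Cons)
  qed simp
  obtain S where S: "finite S" "card S \<le> length us" "forms t \<subseteq> P3.span ((I \<inter> forms t) \<union> S)"
    using codim unfolding codim_le_def by blast
  obtain vs where vs: "set vs = S" "length vs = card S"
    using finite_distinct_list[OF S(1)] distinct_card by metis
  have carr: "set (map ?p vs) \<subseteq> carrier ?Q" using p_carr by auto
  have sub: "?p f \<in> ring.Span ?Q K (map ?p vs)" if "f \<in> P3.span ((I \<inter> forms t) \<union> S)" for f
    using that
  proof (induction rule: P3.span_induct_alt)
    case base
    then show ?case using p_zero[OF I'(1)] Q.Span_subgroup_props(2)[OF K carr] by simp
  next
    case (step c x y)
    have "?p x \<in> ring.Span ?Q K (map ?p vs)"
      using step(1) p_zero Q.Span_subgroup_props(2)[OF K carr] Q.Span_base_incl[OF K carr] vs(1) by auto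
    moreover have "?p (const3 c) \<in> K" by (simp add: K_def)
    ultimately have "?p (const3 c) \<otimes>\<^bsub>?Q\<^esub> ?p x \<in> ring.Span ?Q K (map ?p vs)"
      using Q.Span_smult_closed[OF K carr] by blast
    then show ?case unfolding p_add p_mult using step Q.Span_subgroup_props(3)[OF K carr] by blast
  qed
  have "P3.span (set us) \<subseteq> forms t" using us by (intro P3.span_minimal forms_subspace) auto
  then have "ring.Span ?Q K (map ?p us) \<subseteq> ?p ` forms t" using Span_sub by blast
  then have "ring.dim ?Q K (?p ` forms t) = length (map ?p us)"
    using S(2,3) sub vs(2) by (intro Q.dim_eqI[OF K indep _ carr]) auto
  then show ?thesis by (simp add: hilbert_fun_def K_def I_def)
qed

section \<open>Lines with no three concurrent\<close>

text \<open>The lines \<open>x\<^sub>1 + i x\<^sub>2 + i\<^sup>2 x\<^sub>3 = 0\<close> are points of a conic in the dual plane, so no three of them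
  meet. In characteristic zero there are infinitely many. The form of line \<open>i\<close> takes the value
  \<open>(i - j) (i - k)\<close> at the intersection of the lines \<open>j\<close> and \<open>k\<close>, and all intersections have last
  coordinate \<open>1\<close>.\<close>

definition line_form :: "nat \<Rightarrow> 'k::field poly3" where
  "line_form i = var3 1 + const3 (of_nat i) * var3 2 + const3 ((of_nat i)\<^sup>2) * var3 3"

text \<open>A parametrisation of line \<open>i\<close> under which the parameter \<open>j\<close> gives the intersection with
  line \<open>j\<close>.\<close>

definition line_base :: "nat \<Rightarrow> 'k::field ^ 3" where
  "line_base i = vector [0, - of_nat i, 1]"

definition line_dir :: "nat \<Rightarrow> 'k::field ^ 3" where
  "line_dir i = vector [of_nat i, - 1, 0]"

definition node :: "nat \<Rightarrow> nat \<Rightarrow> 'k::field ^ 3" where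
  "node i j = vector [of_nat i * of_nat j, - (of_nat i + of_nat j), 1]"

lemma node_3: "node i j $ 3 = (1 :: 'k::field)"
  by (simp add: node_def vector_3)

lemma node_commute: "node i j = node j i"
  by (simp add: node_def mult.commute add.commute)

lemma node_on_line: "node i j = line_base i + of_nat j *s line_dir i"
  by (simp add: vec_eq_iff forall_3 node_def line_base_def line_dir_def vector_3 algebra_simps)

lemma line_form_in_forms: "line_form i \<in> forms 1"
  unfolding line_form_def
  by (intro P3.subspace_add[OF forms_subspace] P3.subspace_scale[OF forms_subspace] var3_in_forms)

lemma restr_line_form:
  fixes v w :: "'k::field ^ 3"
  shows "restr v w (line_form i) = [: v $ 1 + of_nat i * v $ 2 + (of_nat i)\<^sup>2 * v $ 3,
       w $ 1 + of_nat i * w $ 2 + (of_nat i)\<^sup>2 * w $ 3 :]"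
  by (simp add: line_form_def restr_add restr_mult)

lemma restr_line_form_self [simp]: "restr (line_base i) (line_dir i) (line_form i) = 0"
  by (simp add: restr_line_form line_base_def line_dir_def vector_3 power2_eq_square)

lemma restr_node_line_form:
  fixes w :: "'k::field ^ 3"
  shows "restr (node j k) w (line_form i) = [: (of_nat i - of_nat j) * (of_nat i - of_nat k),
       w $ 1 + of_nat i * w $ 2 + (of_nat i)\<^sup>2 * w $ 3 :]"
  by (simp add: restr_line_form node_def vector_3 power2_eq_square algebra_simps)

lemma linear_power_dvd_cancel:
  fixes p q :: "'k::field poly"
  assumes "[:- a, 1:] ^ m dvd p * q" "poly p a \<noteq> 0"
  shows "[:- a, 1:] ^ m dvd q"
  using assms(1)
proof (induction m arbitrary: q)
  case (Suc m)
  have "[:- a, 1:] dvd p * q" using Suc.prems dvd_mult_left unfolding power_Suc by blast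
  then have "poly q a = 0" using assms(2) by (simp flip: poly_eq_0_iff_dvd)
  then obtain r where r: "q = [:- a, 1:] * r" by (auto simp: poly_eq_0_iff_dvd)
  have "[:- a, 1:] * [:- a, 1:] ^ m dvd [:- a, 1:] * (p * r)"
    using Suc.prems unfolding r by (simp only: power_Suc mult.left_commute)
  then have "[:- a, 1:] ^ m dvd p * r" by (simp only: dvd_mult_cancel_left) simp
  then have "[:- a, 1:] ^ m dvd r" by (rule Suc.IH)
  then show ?case unfolding r by (simp only: power_Suc mult_dvd_mono dvd_refl)
qed simp

lemma prod_linear_power_dvd:
  fixes p :: "'k::field_char_0 poly"
  assumes "finite S" "\<And>s. s \<in> S \<Longrightarrow> [:- of_nat s, 1:] ^ e s dvd p"
  shows "(\<Prod>s\<in>S. [:- of_nat s, 1:] ^ e s) dvd p"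
  using assms
proof (induction S)
  case (insert s S)
  have "(\<Prod>s\<in>S. [:- of_nat s, 1:] ^ e s) dvd p" using insert by simp
  then obtain r where r: "p = (\<Prod>s\<in>S. [:- of_nat s, 1:] ^ e s) * r" by (rule dvdE)
  have "poly (\<Prod>s\<in>S. [:- of_nat s, 1:] ^ e s) (of_nat s) \<noteq> (0::'k)"
    using insert by (auto simp: poly_prod)
  then have "[:- of_nat s, 1:] ^ e s dvd r"
    using insert.prems[of s] unfolding r by (rule linear_power_dvd_cancel[rotated]) simp
  then show ?case
    unfolding r prod.insert[OF insert.hyps] mult.commute[of "[:- of_nat s, 1:] ^ e s"]
    by (rule mult_dvd_mono[OF dvd_refl])
qed simp

text \<open>Off the line, its form is a unit to every order.\<close>

lemma vanishes_to_cancel_line: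
  assumes "vanishes_to m (node j k) (line_form i * g)" "i \<noteq> j" "i \<noteq> k"
  shows "vanishes_to m (node j k :: 'k::field_char_0 ^ 3) g"
  unfolding vanishes_to_def
proof
  fix w
  have "[:- 0, 1:] ^ m dvd restr (node j k) w (line_form i) * restr (node j k) w g"
    using assms(1) by (simp add: vanishes_to_def restr_mult)
  then have "[:- 0, 1:] ^ m dvd restr (node j k) w g"
    by (rule linear_power_dvd_cancel) (use assms(2,3) in \<open>simp add: restr_node_line_form\<close>)
  then show "[:0, 1:] ^ m dvd restr (node j k) w g" by simp
qed

lemma vanishes_to_line: "vanishes_to 1 (node i k) (line_form i)"
  unfolding vanishes_to_def restr_node_line_form
  by (auto simp: poly_eq_0_iff_dvd[of _ 0, simplified, symmetric])

text \<open>On the line, division by its form costs one order. A single direction transversal to the line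
  suffices, since order one only concerns the value at the point.\<close>

lemma vanishes_to_cancel_line_on:
  assumes "vanishes_to 2 (node i k) (line_form i * g)"
  shows "vanishes_to 1 (node i k :: 'k::field ^ 3) g"
proof -
  let ?v = "node i k :: 'k ^ 3"
  have "[:0, 1:] ^ 2 dvd [:0, 1:] * restr ?v (axis 1 1) g"
  proof -
    have "restr ?v (axis 1 1) (line_form i) = [:0, 1:]"
      by (simp add: restr_node_line_form axis_def)
    then show ?thesis using assms unfolding vanishes_to_def by (metis restr_mult)
  qed
  then have "[:0, 1:] dvd restr ?v (axis 1 1) g"
    by (simp only: power2_eq_square dvd_mult_cancel_left) simp
  then have "poly (restr ?v (axis 1 1) g) 0 = 0" by (simp add: poly_eq_0_iff_dvd)
  then show ?thesis using eval3_eq_restr[of g ?v "axis 1 1"] unfolding vanishes_to_1_iff by simp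
qed

text \<open>A form of degree \<open>t\<close> whose restriction to line \<open>i\<close> is \<open>T\<^sup>s\<close>.\<close>

definition lift_power :: "nat \<Rightarrow> nat \<Rightarrow> nat \<Rightarrow> 'k::field poly3" where
  "lift_power i t s = (- (var3 2 + const3 (of_nat i) * var3 3)) ^ s * var3 3 ^ (t - s)"

lemma lift_power_in_forms: "s \<le> t \<Longrightarrow> lift_power i t s \<in> forms t"
proof -
  assume "s \<le> t"
  have "- (var3 2 + const3 (of_nat i) * var3 3) \<in> forms 1"
    by (intro P3.subspace_neg[OF forms_subspace] P3.subspace_add[OF forms_subspace]
          P3.subspace_scale[OF forms_subspace] var3_in_forms)
  then have "lift_power i t s \<in> forms (s * 1 + (t - s) * 1)"
    unfolding lift_power_def by (intro forms_mult forms_power var3_in_forms)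
  then show ?thesis using \<open>s \<le> t\<close> by simp
qed

lemma restr_lift_power: "restr (line_base i) (line_dir i) (lift_power i t s) = [:0, 1:] ^ s"
  by (simp add: lift_power_def restr_mult restr_power restr_minus restr_add restr_diff line_base_def
      line_dir_def vector_3 flip: one_pCons)

text \<open>Modulo the form of the line, only two variables are left, and the terms of degree \<open>t\<close> in them are
  the lifts of the powers of the parameter. The multiples of the line form are present only in
  positive degree.\<close>

lemma forms_subset_span_lift:
  assumes "f \<in> forms t"
  shows "f \<in> P3.span ((if t = 0 then {} else (*) (line_form i) ` forms (t - 1)) \<union> lift_power i t ` {..t})"
  using assms
proof (induction rule: forms_induct)
  case (const c)
  have "const3 c * lift_power i 0 0 \<in> P3.span (lift_power i 0 ` {..0})"
    by (intro P3.span_scale P3.span_base) simp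
  then show ?case by (simp add: lift_power_def)
next
  case (var t j f)
  let ?l = "line_form i :: 'a poly3" and ?z = "var3 3 :: 'a poly3"
  define y where "y = - (var3 2 + const3 (of_nat i) * ?z)"
  define M where "M = (*) ?l ` forms t \<union> lift_power i (Suc t) ` {..Suc t}"
  have "\<exists>a b c. var3 j = const3 a * ?l + const3 b * y + const3 c * ?z"
  proof -
    have "j = 1 \<or> j = 2 \<or> j = 3" by (rule exhaust_3)
    moreover have "var3 1 = const3 1 * ?l + const3 (of_nat i) * y + const3 0 * ?z"
      by (simp only: line_form_def y_def power2_eq_square const3_mult const3_0 const3_1) (simp add: distrib_left right_diff_distrib mult.assoc)
    moreover have "var3 2 = const3 0 * ?l + const3 (- 1) * y + const3 (- of_nat i) * ?z"
      by (simp only: const3_minus const3_1 const3_0 y_def) simp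
    moreover have "?z = const3 0 * ?l + const3 0 * y + const3 1 * ?z"
      by simp
    ultimately show ?thesis by metis
  qed
  then obtain a b c where j: "var3 j = const3 a * ?l + const3 b * y + const3 c * ?z" by blast
  have gen: "var3 j * g \<in> P3.span M"
    if g: "g \<in> (if t = 0 then {} else (*) ?l ` forms (t - 1)) \<union> lift_power i t ` {..t}" for g
    using g
  proof
    assume "g \<in> (if t = 0 then {} else (*) ?l ` forms (t - 1))"
    then obtain h where "t \<noteq> 0" "h \<in> forms (t - 1)" "g = ?l * h" by (auto split: if_splits)
    then have "var3 j * g = ?l * (var3 j * h)" "var3 j * h \<in> forms t"
      using forms_mult[OF var3_in_forms[of j], of h "t - 1"] by auto
    then show ?thesis unfolding M_def by (intro P3.span_base) auto
  next
    assume "g \<in> lift_power i t ` {..t}"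
    then obtain s where s: "s \<le> t" "g = lift_power i t s" by auto
    have "?l * g \<in> M" using s lift_power_in_forms by (auto simp: M_def)
    moreover have "y * g = lift_power i (Suc t) (Suc s)"
      using s by (simp add: lift_power_def y_def)
    then have "y * g \<in> M" using s by (auto simp: M_def)
    moreover have "?z * g = lift_power i (Suc t) s"
      using s by (simp add: lift_power_def Suc_diff_le)
    then have "?z * g \<in> M" using s by (auto simp: M_def)
    ultimately have "const3 a * (?l * g) + const3 b * (y * g) + const3 c * (?z * g) \<in> P3.span M"
      by (intro P3.span_add P3.span_scale P3.span_base)
    then show ?thesis unfolding j distrib_right mult.assoc .
  qed
  have "var3 j * f \<in> P3.span M"
    using var.IH
  proof (induction rule: P3.span_induct_alt)
    case base
    show ?case by (simp add: P3.span_zero)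
  next
    case (step c x y)
    have "const3 c * (var3 j * x) + var3 j * y \<in> P3.span M"
      by (rule P3.span_add[OF P3.span_scale[OF gen[OF step(1)]] step(2)])
    then show ?case by (simp only: distrib_left mult.left_commute[of "var3 j"])
  qed
  then show ?case by (simp add: M_def)
qed (rule P3.span_add)

lemma codim_le_forms_0: "codim_le (forms 0) W 1"
proof -
  have "forms 0 \<subseteq> P3.span (W \<union> {1})"
  proof
    fix f :: "'a poly3" assume "f \<in> forms 0"
    then obtain c where "f = const3 c * 1" by (auto simp: forms_0_eq)
    then show "f \<in> P3.span (W \<union> {1})" by (metis P3.span_scale P3.span_base UnI2 singletonI)
  qed
  then show ?thesis unfolding codim_le_def by (intro exI[of _ "{1}"]) simp
qed

lemma codim_le_forms_line: "codim_le (forms (Suc t)) ((*) (line_form i) ` forms t) (Suc (Suc t))"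
  unfolding codim_le_def
proof (intro exI conjI)
  show "forms (Suc t) \<subseteq> P3.span ((*) (line_form i) ` forms t \<union> lift_power i (Suc t) ` {..Suc t})"
    using forms_subset_span_lift[of _ "Suc t" i] by auto
  show "card (lift_power i (Suc t) ` {..Suc t}) \<le> Suc (Suc t)"
    using card_image_le[of "{..Suc t}" "lift_power i (Suc t)"] by simp
qed simp

section \<open>Removing lines\<close>

text \<open>The forms of degree \<open>t\<close> that vanish on what is left of the double points at the nodes in \<open>A\<close> when
  the lines \<open>1, \<dots>, i\<close> are removed: the multiplicity of a node is the number of its two lines that
  are still present.\<close>

definition residual :: "(nat \<times> nat) set \<Rightarrow> nat \<Rightarrow> nat \<Rightarrow> 'k::field poly3 set" where
  "residual A i t = {f \<in> forms t. \<forall>(j, k)\<in>A. vanishes_to (of_bool (i < j) + of_bool (i < k)) (node j k) f}"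

text \<open>The degree of the intersection of line \<open>i\<close> with what is left when its turn comes: its nodes with
  later lines are still double, those with earlier lines are simple.\<close>

definition line_degree :: "(nat \<times> nat) set \<Rightarrow> nat \<Rightarrow> nat" where
  "line_degree A i = 2 * card {k. (i, k) \<in> A} + card {j. (j, i) \<in> A}"

lemma residualI:
  assumes "f \<in> forms t"
    and "\<And>j k. (j, k) \<in> A \<Longrightarrow> vanishes_to (of_bool (i < j) + of_bool (i < k)) (node j k) f"
  shows "f \<in> residual A i t"
  using assms unfolding residual_def by blast

lemma residualD:
  assumes "f \<in> residual A i t"
  shows "f \<in> forms t"
    and "(j, k) \<in> A \<Longrightarrow> vanishes_to (of_bool (i < j) + of_bool (i < k)) (node j k) f"
  using assms unfolding residual_def by blast+

lemma residual_subspace: "P3.subspace (residual A i t)"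
proof (rule P3.subspaceI)
  show "0 \<in> residual A i t"
    by (intro residualI P3.subspace_0[OF forms_subspace]) (simp add: vanishes_to_def)
next
  fix f g :: "'a poly3" assume "f \<in> residual A i t" "g \<in> residual A i t"
  then show "f + g \<in> residual A i t"
    by (intro residualI P3.subspace_add[OF forms_subspace] vanishes_to_add) (simp_all add: residualD)
next
  fix c and f :: "'a poly3" assume "f \<in> residual A i t"
  then show "const3 c * f \<in> residual A i t"
    using vanishes_to_mult[of 0 _ "const3 c"]
    by (intro residualI P3.subspace_scale[OF forms_subspace]) (simp_all add: residualD)
qed

lemma codim_le_superset:
  assumes "codim_le V W n" "W \<subseteq> W'"
  shows "codim_le V W' n"
proof -
  obtain S where S: "finite S" "card S \<le> n" "V \<subseteq> P3.span (W \<union> S)"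
    using assms(1) unfolding codim_le_def by blast
  have "P3.span (W \<union> S) \<subseteq> P3.span (W' \<union> S)" using assms(2) by (intro P3.span_mono) blast
  then show ?thesis using S unfolding codim_le_def by blast
qed

locale node_pairs =
  fixes \<alpha> :: nat and A :: "(nat \<times> nat) set"
  assumes ordered: "(j, k) \<in> A \<Longrightarrow> 1 \<le> j \<and> j < k \<and> k \<le> \<alpha>"
begin

lemma finite_pairs: "finite {k. (i, k) \<in> A}" "finite {j. (j, i) \<in> A}"
proof -
  show "finite {k. (i, k) \<in> A}" by (rule finite_subset[of _ "{..\<alpha>}"]) (auto dest: ordered)
  show "finite {j. (j, i) \<in> A}" by (rule finite_subset[of _ "{..<i}"]) (auto dest: ordered)
qed

lemma line_mult_residual:
  assumes "g \<in> residual A (Suc i) t"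
  shows "line_form (Suc i) * g \<in> residual A i (Suc t)"
proof -
  have "line_form (Suc i) * g \<in> forms (Suc t)"
    using assms forms_mult[OF line_form_in_forms, of g t] by (simp add: residual_def)
  moreover have "vanishes_to (of_bool (i < j) + of_bool (i < k)) (node j k) (line_form (Suc i) * g)"
    if A: "(j, k) \<in> A" for j k
  proof -
    have g: "vanishes_to (of_bool (Suc i < j) + of_bool (Suc i < k)) (node j k) g"
      using residualD(2)[OF assms A] .
    have "vanishes_to (of_bool (j = Suc i \<or> k = Suc i)) (node j k) (line_form (Suc i))"
    proof -
      consider "j = Suc i" | "k = Suc i" | "j \<noteq> Suc i" "k \<noteq> Suc i" by blast
      then show ?thesis
      proof cases
        case 1
        then show ?thesis using vanishes_to_line[of "Suc i" k] by simp
      next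
        case 2
        then show ?thesis using vanishes_to_line[of "Suc i" j] unfolding node_commute[of j] by simp
      qed simp
    qed
    from vanishes_to_mult[OF this g] show ?thesis
      by (rule vanishes_to_mono) (use ordered[OF A] in \<open>auto simp: of_bool_def\<close>)
  qed
  ultimately show ?thesis by (rule residualI)
qed

lemma residual_cancel_line:
  fixes g :: "'k::field_char_0 poly3"
  assumes "g \<in> forms t" "line_form (Suc i) * g \<in> residual A i (Suc t)"
  shows "g \<in> residual A (Suc i) t"
proof -
  have "vanishes_to (of_bool (Suc i < j) + of_bool (Suc i < k)) (node j k) g"
    if A: "(j, k) \<in> A" for j k
  proof -
    have v: "vanishes_to (of_bool (i < j) + of_bool (i < k)) (node j k) (line_form (Suc i) * g)"
      using residualD(2)[OF assms(2) A] .
    consider "Suc i = j" | "Suc i = k" | "Suc i \<noteq> j" "Suc i \<noteq> k" by blast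
    then show ?thesis
    proof cases
      case 1
      then show ?thesis using v vanishes_to_cancel_line_on[of "Suc i" k g] ordered[OF A] by (simp add: numeral_2_eq_2)
    next
      case 2
      then show ?thesis using ordered[OF A] by simp
    next
      case 3
      then have "(i < j) = (Suc i < j)" "(i < k) = (Suc i < k)" by auto
      then show ?thesis using v vanishes_to_cancel_line[of _ j k "Suc i" g] 3 by simp
    qed
  qed
  with assms(1) show ?thesis by (rule residualI)
qed

text \<open>The intersection of degree \<open>line_degree A i\<close>, as a divisor on line \<open>i\<close> in its parameter: a root
  of order two for each double point and of order one for each simple point.\<close>

definition line_poly :: "nat \<Rightarrow> 'k::field_char_0 poly" where
  "line_poly i = (\<Prod>s\<in>{k. (i, k) \<in> A} \<union> {j. (j, i) \<in> A}. [:- of_nat s, 1:] ^ (if i < s then 2 else 1))"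

lemma degree_line_poly: "degree (line_poly i :: 'k::field_char_0 poly) = line_degree A i"
proof -
  let ?e = "\<lambda>s. if i < s then 2 else 1 :: nat"
  have "degree (line_poly i :: 'k poly) = (\<Sum>s\<in>{k. (i, k) \<in> A} \<union> {j. (j, i) \<in> A}. degree ([:- of_nat s, 1:] ^ ?e s :: 'k poly))"
    unfolding line_poly_def by (rule degree_prod_eq_sum_degree) simp
  also have "\<dots> = (\<Sum>s\<in>{k. (i, k) \<in> A} \<union> {j. (j, i) \<in> A}. ?e s)"
    by (intro sum.cong refl) (simp add: degree_linear_power)
  also have "\<dots> = (\<Sum>s\<in>{k. (i, k) \<in> A}. ?e s) + (\<Sum>s\<in>{j. (j, i) \<in> A}. ?e s)"
    by (intro sum.union_disjoint finite_pairs) (auto dest!: ordered)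
  also have "(\<Sum>s\<in>{k. (i, k) \<in> A}. ?e s) = (\<Sum>s\<in>{k. (i, k) \<in> A}. 2)"
    by (intro sum.cong) (use ordered in auto)
  also have "(\<Sum>s\<in>{j. (j, i) \<in> A}. ?e s) = (\<Sum>s\<in>{j. (j, i) \<in> A}. 1)"
    by (intro sum.cong) (use ordered in fastforce)+
  finally show ?thesis by (simp add: line_degree_def)
qed

lemma line_poly_dvd_restr:
  fixes f :: "'k::field_char_0 poly3"
  assumes "f \<in> residual A i t"
  shows "line_poly (Suc i) dvd restr (line_base (Suc i)) (line_dir (Suc i)) f"
  unfolding line_poly_def
proof (rule prod_linear_power_dvd)
  fix s assume s: "s \<in> {k. (Suc i, k) \<in> A} \<union> {j. (j, Suc i) \<in> A}"
  have "vanishes_to (if Suc i < s then 2 else 1) (node (Suc i) s) f"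
    using s
  proof
    assume "s \<in> {k. (Suc i, k) \<in> A}"
    then have "(Suc i, s) \<in> A" by simp
    then have "vanishes_to (of_bool (i < Suc i) + of_bool (i < s)) (node (Suc i) s) f" "Suc i < s"
      using residualD(2)[OF assms, of "Suc i" s] ordered[of "Suc i" s] by auto
    then show ?thesis by (simp add: numeral_2_eq_2)
  next
    assume "s \<in> {j. (j, Suc i) \<in> A}"
    then have "(s, Suc i) \<in> A" by simp
    then have "vanishes_to (of_bool (i < s) + of_bool (i < Suc i)) (node s (Suc i)) f" "s < Suc i"
      using residualD(2)[OF assms, of s "Suc i"] ordered[of s "Suc i"] by auto
    then show ?thesis by (simp add: node_commute[of s])
  qed
  then show "[:- of_nat s, 1:] ^ (if Suc i < s then 2 else 1) dvd restr (line_base (Suc i)) (line_dir (Suc i)) f"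
    unfolding node_on_line by (rule vanishes_to_imp_power_dvd_restr)
qed (simp add: finite_pairs)

subsection \<open>Independent forms\<close>

text \<open>A relation would give a multiple of \<open>line_poly (Suc i)\<close> of the form \<open>T\<^sup>m\<close> plus lower terms, with
  \<open>m\<close> below its degree. The forms in \<open>vs\<close>, being zero on the line, do not interfere.\<close>

lemma indep_mod_lifts:
  fixes vs :: "'k::field_char_0 poly3 list"
  assumes vs: "indep_mod (residual A i t) vs"
    and restr_vs: "\<And>v. v \<in> set vs \<Longrightarrow> restr (line_base (Suc i)) (line_dir (Suc i)) v = 0"
    and m: "m \<le> line_degree A (Suc i)"
  shows "indep_mod (residual A i t) (map (lift_power (Suc i) t) (rev [0..<m]) @ vs)"
  using m
proof (induction m)
  case (Suc m)
  let ?r = "restr (line_base (Suc i)) (line_dir (Suc i)) :: 'k poly3 \<Rightarrow> 'k poly"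
  let ?q = "line_poly (Suc i) :: 'k poly"
  let ?us = "map (lift_power (Suc i) t) (rev [0..<m]) @ vs"
  have span: "\<exists>p r. ?r x = ?q * p + r \<and> (\<forall>n\<ge>m. coeff r n = 0)"
    if "x \<in> P3.span (residual A i t \<union> set ?us)" for x
    using that
  proof (induction rule: P3.span_induct_alt)
    case base
    show ?case by (intro exI[of _ 0]) simp
  next
    case (step c x y)
    have "\<exists>p r. ?r x = ?q * p + r \<and> (\<forall>n\<ge>m. coeff r n = 0)"
    proof -
      consider "x \<in> residual A i t" | "x \<in> set vs" | s where "s < m" "x = lift_power (Suc i) t s"
        using step(1) by auto
      then show ?thesis
      proof cases
        case 1
        then obtain p where "?r x = ?q * p" using line_poly_dvd_restr by (meson dvdE)
        then show ?thesis by (intro exI[of _ p] exI[of _ 0]) simp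
      next
        case 2
        then show ?thesis by (intro exI[of _ 0]) (simp add: restr_vs)
      next
        case 3
        then show ?thesis
          by (intro exI[of _ 0] exI[of _ "[:0, 1:] ^ s"])
             (auto simp: restr_lift_power monom_altdef[of 1, simplified, symmetric])
      qed
    qed
    then obtain p r where x: "?r x = ?q * p + r" "\<forall>n\<ge>m. coeff r n = 0" by blast
    obtain p' r' where y: "?r y = ?q * p' + r'" "\<forall>n\<ge>m. coeff r' n = 0" using step by blast
    have "?r (const3 c * x + y) = ?q * (smult c p + p') + (smult c r + r')"
      by (simp add: restr_add restr_mult x y distrib_left smult_add_right)
    moreover have "\<forall>n\<ge>m. coeff (smult c r + r') n = 0" using x y by simp
    ultimately show ?case by blast
  qed
  have "lift_power (Suc i) t m \<notin> P3.span (residual A i t \<union> set ?us)"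
  proof
    assume "lift_power (Suc i) t m \<in> P3.span (residual A i t \<union> set ?us)"
    then obtain p r where pr: "[:0, 1:] ^ m = ?q * p + r" "\<forall>n\<ge>m. coeff r n = 0"
      using span restr_lift_power by metis
    have c: "coeff (?q * p) n = (if n = m then 1 else 0)" if "n \<ge> m" for n
    proof -
      have "coeff (?q * p) n = coeff ([:0, 1:] ^ m :: 'k poly) n" using pr that by simp
      then show ?thesis by (simp add: monom_altdef[of 1, simplified, symmetric])
    qed
    have "?q * p \<noteq> 0" using c[of m] by auto
    then have "degree (?q * p) = degree ?q + degree p" by (intro degree_mult_eq) auto
    then have "m < degree (?q * p)" using Suc.prems by (simp add: degree_line_poly)
    then have "coeff (?q * p) (degree (?q * p)) = 0" using c by simp
    then show False using \<open>?q * p \<noteq> 0\<close> by simp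
  qed
  then show ?case using Suc by simp
qed (simp add: vs)

text \<open>A relation between multiples of the line form can be divided by it.\<close>

lemma indep_mod_mult_line:
  fixes us :: "'k::field_char_0 poly3 list"
  assumes "set us \<subseteq> forms t" "indep_mod (residual A (Suc i) t) us"
  shows "indep_mod (residual A i (Suc t)) (map ((*) (line_form (Suc i))) us)"
  using assms
proof (induction us)
  case (Cons u us)
  let ?l = "line_form (Suc i) :: 'k poly3"
  have span: "\<exists>w g. w \<in> residual A i (Suc t) \<and> g \<in> P3.span (set us) \<and> x = w + ?l * g"
    if "x \<in> P3.span (residual A i (Suc t) \<union> (*) ?l ` set us)" for x
    using that
  proof (induction rule: P3.span_induct_alt)
    case base
    show ?case using P3.subspace_0[OF residual_subspace] P3.span_zero by force
  next
    case (step c x y)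
    then obtain w g where y: "w \<in> residual A i (Suc t)" "g \<in> P3.span (set us)" "y = w + ?l * g" by blast
    from step(1) show ?case
    proof
      assume "x \<in> residual A i (Suc t)"
      then have "const3 c * x + w \<in> residual A i (Suc t)"
        using y(1) by (intro P3.subspace_add[OF residual_subspace] P3.subspace_scale[OF residual_subspace])
      moreover have "const3 c * x + y = (const3 c * x + w) + ?l * g" unfolding y(3) by (rule add.assoc[symmetric])
      ultimately show ?thesis using y(2) by blast
    next
      assume "x \<in> (*) ?l ` set us"
      then obtain v where v: "v \<in> set us" "x = ?l * v" by auto
      then have "const3 c * v + g \<in> P3.span (set us)"
        using y(2) by (intro P3.span_add[OF P3.span_scale[OF P3.span_base]])
      moreover have "const3 c * x + y = w + ?l * (const3 c * v + g)"
        unfolding v(2) y(3) distrib_left mult.left_commute[of ?l "const3 c"] by (rule add.left_commute)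
      ultimately show ?thesis using y(1) by blast
    qed
  qed
  have "?l * u \<notin> P3.span (residual A i (Suc t) \<union> (*) ?l ` set us)"
  proof
    assume "?l * u \<in> P3.span (residual A i (Suc t) \<union> (*) ?l ` set us)"
    then obtain w g where wg: "w \<in> residual A i (Suc t)" "g \<in> P3.span (set us)" "?l * u = w + ?l * g"
      using span by blast
    have "P3.span (set us) \<subseteq> forms t" using Cons.prems by (intro P3.span_minimal forms_subspace) auto
    then have "u - g \<in> forms t" using wg(2) Cons.prems(1) by (auto intro: P3.subspace_diff[OF forms_subspace])
    moreover have "?l * (u - g) = w" using wg(3) by (simp add: right_diff_distrib)
    ultimately have "u - g \<in> residual A (Suc i) t" using wg(1) by (intro residual_cancel_line) simp_all
    then have "(u - g) + g \<in> P3.span (residual A (Suc i) t \<union> set us)"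
      using wg(2) P3.span_mono[of "set us" "residual A (Suc i) t \<union> set us"]
      by (intro P3.span_add[OF P3.span_base]) auto
    then show False using Cons.prems(2) by simp
  qed
  then show ?case using Cons by simp
qed simp

text \<open>The common value of the lower and the upper bound for the codimension of \<open>residual A i t\<close>. The
  subtraction is truncated: when \<open>j\<close> exceeds \<open>t + 2 + i\<close>, the degree has dropped below zero
  before line \<open>j\<close> is reached.\<close>

definition hilbert_value :: "nat \<Rightarrow> nat \<Rightarrow> nat" where
  "hilbert_value i t = (\<Sum>j\<in>{i<..\<alpha>}. min (t + 2 + i - j) (line_degree A j))"

lemma hilbert_value_0:
  assumes "i < \<alpha>" shows "hilbert_value i 0 = min 1 (line_degree A (Suc i))"
proof -
  have "{i<..\<alpha>} = insert (Suc i) {Suc i<..\<alpha>}" using assms by auto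
  moreover have "(\<Sum>j\<in>{Suc i<..\<alpha>}. min (2 + i - j) (line_degree A j)) = 0"
    by (intro sum.neutral) auto
  ultimately show ?thesis by (simp add: hilbert_value_def)
qed

lemma hilbert_value_Suc:
  assumes "i < \<alpha>"
  shows "hilbert_value i (Suc t) = min (t + 2) (line_degree A (Suc i)) + hilbert_value (Suc i) t"
proof -
  have "{i<..\<alpha>} = insert (Suc i) {Suc i<..\<alpha>}" using assms by auto
  then show ?thesis by (simp add: hilbert_value_def)
qed

lemma independent_forms_mod_residual:
  assumes "i \<le> \<alpha>"
  shows "\<exists>us :: 'k::field_char_0 poly3 list.
    set us \<subseteq> forms t \<and> indep_mod (residual A i t) us \<and> length us = hilbert_value i t"
  using assms
proof (induction i arbitrary: t rule: inc_induct)
  case base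
  show ?case by (intro exI[of _ "[]"]) (simp add: hilbert_value_def)
next
  case (step i)
  show ?case
  proof (cases t)
    case 0
    have "indep_mod (residual A i 0) (map (lift_power (Suc i) 0) (rev [0..<min 1 (line_degree A (Suc i))]) @ ([] :: 'k poly3 list))"
      by (intro indep_mod_lifts) auto
    moreover have "set (map (lift_power (Suc i) 0) (rev [0..<min 1 (line_degree A (Suc i))]) @ ([] :: 'k poly3 list)) \<subseteq> forms 0"
      by (auto intro!: lift_power_in_forms)
    ultimately show ?thesis unfolding 0 hilbert_value_0[OF step(2)] by (intro exI conjI) auto
  next
    case (Suc t')
    obtain us :: "'k poly3 list" where us: "set us \<subseteq> forms t'" "indep_mod (residual A (Suc i) t') us"
      "length us = hilbert_value (Suc i) t'" using step.IH by blast
    let ?m = "min (t' + 2) (line_degree A (Suc i))"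
    let ?vs = "map (lift_power (Suc i) t) (rev [0..<?m]) @ map ((*) (line_form (Suc i))) us"
    have "indep_mod (residual A i t) ?vs"
      unfolding Suc by (intro indep_mod_lifts indep_mod_mult_line us) (auto simp: restr_mult)
    moreover have "set ?vs \<subseteq> forms t"
      using us(1) forms_mult[OF line_form_in_forms, of _ t' "Suc i"] by (auto simp: Suc intro!: lift_power_in_forms)
    moreover have "length ?vs = hilbert_value i t"
      unfolding Suc hilbert_value_Suc[OF step(2)] by (simp add: us)
    ultimately show ?thesis by blast
  qed
qed

subsection \<open>Spanning forms\<close>

text \<open>Putting line \<open>Suc i\<close> back turns its nodes with later lines from simple into double, at the cost of
  two derivatives each, and imposes a value at its nodes with earlier lines.\<close>

lemma codim_le_residual_step:
  "codim_le (residual A (Suc i) t :: 'k::field_char_0 poly3 set) (residual A i t) (line_degree A (Suc i))"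
proof -
  let ?V = "residual A (Suc i) t :: 'k poly3 set"
  let ?J = "{j. (j, Suc i) \<in> A}" and ?K = "{k. (Suc i, k) \<in> A}"
  define I where "I = ?K \<times> {1, 2::nat} \<union> ?J \<times> {0}"
  \<comment> \<open>The second component of an index is \<open>0\<close> for a value, otherwise the axis of a derivative.\<close>
  define \<phi> where "\<phi> = (\<lambda>(s, b) f. if b = 0 then eval3 f (node s (Suc i))
     else coeff (restr (node (Suc i) s) (axis (of_nat b) 1) f) 1 :: 'k)"
  have I: "finite I" by (simp add: I_def finite_pairs)
  have "card I = card (?K \<times> {1, 2::nat}) + card (?J \<times> {0::nat})"
    unfolding I_def by (intro card_Un_disjoint) (auto simp: finite_pairs)
  then have card: "card I = line_degree A (Suc i)" by (simp add: line_degree_def card_cartesian_product)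
  have "codim_le ?V {f \<in> ?V. \<forall>x\<in>I. \<phi> x f = 0} (card I)"
    by (intro codim_le_kernels I residual_subspace)
       (auto simp: \<phi>_def eval3_eq_restr[of _ _ 0] restr_add restr_mult)
  moreover have "{f \<in> ?V. \<forall>x\<in>I. \<phi> x f = 0} \<subseteq> residual A i t"
  proof clarify
    fix f assume f: "f \<in> ?V" "\<forall>x\<in>I. \<phi> x f = 0"
    have "vanishes_to (of_bool (i < j) + of_bool (i < k)) (node j k) f" if A: "(j, k) \<in> A" for j k
    proof -
      have v: "vanishes_to (of_bool (Suc i < j) + of_bool (Suc i < k)) (node j k) f"
        using residualD(2)[OF f(1) A] .
      consider "Suc i = j" | "Suc i = k" | "Suc i \<noteq> j" "Suc i \<noteq> k" by blast
      then show ?thesis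
      proof cases
        case 1
        then have "(k, 1) \<in> I" "(k, 2) \<in> I" using A by (auto simp: I_def)
        then have "\<phi> (k, 1) f = 0" "\<phi> (k, 2) f = 0" using f(2) by blast+
        then have "coeff (restr (node j k) (axis 1 1) f) 1 = 0" "coeff (restr (node j k) (axis 2 1) f) 1 = 0"
          using 1 by (simp_all add: \<phi>_def)
        moreover have "eval3 f (node j k) = 0"
          using v 1 ordered[OF A] by (simp flip: vanishes_to_1_iff)
        ultimately have "vanishes_to 2 (node j k) f"
          using residualD(1)[OF f(1)] vanishes_to_2_iff[of f t "node j k"] node_3 by blast
        then show ?thesis by (rule vanishes_to_mono) (simp add: of_bool_def)
      next
        case 2
        then have "(j, 0) \<in> I" using A by (auto simp: I_def)
        then have "\<phi> (j, 0) f = 0" using f(2) by blast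
        then have "vanishes_to 1 (node j k) f" using 2 unfolding vanishes_to_1_iff by (simp add: \<phi>_def)
        then show ?thesis by (rule vanishes_to_mono) (use 2 ordered[OF A] in \<open>simp add: of_bool_def\<close>)
      next
        case 3
        then have "(i < j) = (Suc i < j)" "(i < k) = (Suc i < k)" by auto
        then show ?thesis using v by simp
      qed
    qed
    with residualD(1)[OF f(1)] show "f \<in> residual A i t" by (rule residualI)
  qed
  ultimately show ?thesis unfolding card by (rule codim_le_superset)
qed

text \<open>If line \<open>Suc i\<close> imposes at most \<open>t + 1\<close> conditions, these are counted on top of the bound for the
  remaining lines in the same degree; otherwise the multiples of its form, which lie in codimension
  \<open>t + 1\<close>, give a better bound.\<close>

lemma codim_le_forms_residual:
  assumes decreasing: "\<And>j. 1 \<le> j \<Longrightarrow> j < \<alpha> \<Longrightarrow> line_degree A (Suc j) < line_degree A j"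
    and "i \<le> \<alpha>"
  shows "codim_le (forms t :: 'k::field_char_0 poly3 set) (residual A i t) (hilbert_value i t)"
  using assms(2)
proof (induction i arbitrary: t rule: inc_induct)
  case base
  have "forms t \<subseteq> (residual A \<alpha> t :: 'k poly3 set)"
  proof clarify
    fix f :: "'k poly3" assume "f \<in> forms t"
    moreover have "\<not> \<alpha> < j" "\<not> \<alpha> < k" if "(j, k) \<in> A" for j k using ordered[OF that] by auto
    ultimately show "f \<in> residual A \<alpha> t" by (intro residualI) simp_all
  qed
  then show ?case unfolding codim_le_def hilbert_value_def
    by (intro exI[of _ "{}"]) (auto intro: P3.span_base)
next
  case (step i)
  show ?case
  proof (cases "line_degree A (Suc i) \<le> t + 1")
    case True
    \<comment> \<open>By the strict decrease, once one minimum is attained by the degree of its line, so are all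
      later ones.\<close>
    have dec: "line_degree A (Suc i + n) + n \<le> line_degree A (Suc i)" if "Suc i + n \<le> \<alpha>" for n
      using that
    proof (induction n)
      case (Suc n)
      then show ?case using decreasing[of "Suc i + n"] by simp
    qed simp
    have small: "line_degree A j \<le> t + 2 + i - j" if "j \<in> {i<..\<alpha>}" for j
      using dec[of "j - Suc i"] that True by auto
    have "hilbert_value i t = (\<Sum>j\<in>{i<..\<alpha>}. line_degree A j)"
      unfolding hilbert_value_def using small by (intro sum.cong) auto
    also have "{i<..\<alpha>} = insert (Suc i) {Suc i<..\<alpha>}" using step by auto
    also have "(\<Sum>j\<in>insert (Suc i) {Suc i<..\<alpha>}. line_degree A j) = line_degree A (Suc i) + (\<Sum>j\<in>{Suc i<..\<alpha>}. line_degree A j)"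
      by simp
    also have "(\<Sum>j\<in>{Suc i<..\<alpha>}. line_degree A j) = hilbert_value (Suc i) t"
      unfolding hilbert_value_def
    proof (intro sum.cong refl)
      fix j assume "j \<in> {Suc i<..\<alpha>}"
      then show "line_degree A j = min (t + 2 + Suc i - j) (line_degree A j)" using small[of j] by auto
    qed
    finally have "hilbert_value i t = hilbert_value (Suc i) t + line_degree A (Suc i)" by simp
    then show ?thesis using codim_le_trans[OF step.IH codim_le_residual_step] by simp
  next
    case False
    show ?thesis
    proof (cases t)
      case 0
      then show ?thesis using False codim_le_forms_0 by (simp add: hilbert_value_0[OF step(2)])
    next
      case (Suc t')
      have "codim_le (forms t :: 'k poly3 set) ((*) (line_form (Suc i)) ` residual A (Suc i) t') (Suc (Suc t') + hilbert_value (Suc i) t')"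
        unfolding Suc by (rule codim_le_trans[OF codim_le_forms_line codim_le_mult[OF step.IH]])
      moreover have "hilbert_value i t = Suc (Suc t') + hilbert_value (Suc i) t'"
        using False unfolding Suc hilbert_value_Suc[OF step(2)] by simp
      moreover have "(*) (line_form (Suc i)) ` residual A (Suc i) t' \<subseteq> (residual A i t :: 'k poly3 set)"
        using line_mult_residual unfolding Suc by blast
      ultimately show ?thesis using codim_le_superset by metis
    qed
  qed
qed

end

section \<open>Double points at the nodes\<close>

context node_pairs
begin

definition nodes :: "('k::field ^ 3) set" where
  "nodes = (\<lambda>(j, k). node j k) ` A"

lemma nodes_3: "v \<in> nodes \<Longrightarrow> v $ 3 = (1 :: 'k::field)"
  by (auto simp: nodes_def node_3)

lemma finite_nodes: "finite nodes"
proof -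
  have "A \<subseteq> {..\<alpha>} \<times> {..\<alpha>}" by (auto dest: ordered)
  then show ?thesis unfolding nodes_def by (rule finite_imageI[OF finite_subset]) simp
qed

lemma residual_0_eq: "residual A 0 t = fat_ideal (double_points nodes) \<inter> forms t"
proof -
  have "f \<in> residual A 0 t \<longleftrightarrow> f \<in> fat_ideal (double_points nodes)" if "f \<in> forms t" for f :: "'a poly3"
  proof -
    have "f \<in> fat_ideal (double_points nodes) \<longleftrightarrow> (\<forall>v\<in>nodes. vanishes_to 2 v f)"
      by (rule form_in_fat_ideal_iff[OF finite_nodes nodes_3 that])
    also have "\<dots> \<longleftrightarrow> (\<forall>(j, k)\<in>A. vanishes_to 2 (node j k) f)"
      by (auto simp: nodes_def)
    also have "\<dots> \<longleftrightarrow> (\<forall>(j, k)\<in>A. vanishes_to (of_bool (0 < j) + of_bool (0 < k)) (node j k) f)"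
      by (intro ball_cong refl) (auto dest!: ordered simp: numeral_2_eq_2)
    finally show ?thesis using that by (simp add: residual_def)
  qed
  then show ?thesis using residualD(1) by blast
qed

lemma one_notin_fat_ideal:
  assumes "A \<noteq> {}"
  shows "1 \<notin> fat_ideal (double_points (nodes :: ('k::field ^ 3) set))"
proof
  assume "1 \<in> fat_ideal (double_points (nodes :: ('k ^ 3) set))"
  then have "\<forall>v\<in>nodes. vanishes_to 2 v (1 :: 'k poly3)"
    using form_in_fat_ideal_iff[OF finite_nodes nodes_3 one_in_forms] by blast
  moreover obtain v where "v \<in> (nodes :: ('k ^ 3) set)" using assms by (auto simp: nodes_def)
  ultimately have "vanishes_to 2 v 1" by blast
  then have "eval3 1 v = 0" unfolding vanishes_to_1_iff[symmetric] by (rule vanishes_to_mono) simp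
  then show False by (simp add: eval3_eq_restr[of _ _ 0])
qed

theorem hilbert_fun_double_points:
  assumes "\<And>j. 1 \<le> j \<Longrightarrow> j < \<alpha> \<Longrightarrow> line_degree A (Suc j) < line_degree A j"
    and "A \<noteq> {}"
  shows "hilbert_fun (double_points (nodes :: ('k::field_char_0 ^ 3) set)) t = hilbert_value 0 t"
proof -
  obtain us :: "'k poly3 list" where us: "set us \<subseteq> forms t" "indep_mod (residual A 0 t) us"
    "length us = hilbert_value 0 t"
    using independent_forms_mod_residual[of 0 t] by blast
  have "codim_le (forms t :: 'k poly3 set) (residual A 0 t) (hilbert_value 0 t)"
    by (rule codim_le_forms_residual[OF assms(1)]) simp_all
  then show ?thesis
    using us hilbert_fun_eqI[OF ideal_fat_ideal[OF finite_nodes] one_notin_fat_ideal[OF assms(2)]]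
    by (metis residual_0_eq)
qed

lemma double_points_nodes:
  "is_fat_points (double_points (nodes :: ('k::field ^ 3) set))"
  "all_double (double_points (nodes :: ('k::field ^ 3) set))"
proof -
  have "v \<noteq> 0" if "v \<in> nodes" for v :: "'k ^ 3"
    using nodes_3[OF that] by auto
  then show "is_fat_points (double_points (nodes :: ('k ^ 3) set))"
    unfolding is_fat_points_def set_mset_double_points[OF finite_nodes]
    by (auto intro: span_in_proj_plane)
  show "all_double (double_points (nodes :: ('k ^ 3) set))"
    unfolding all_double_def set_mset_double_points[OF finite_nodes]
    by (simp add: count_double_points[OF finite_nodes])
qed

text \<open>Passing from \<open>t - 1\<close> to \<open>t\<close> raises the minimum belonging to \<open>j\<close> by one as long as the degree of
  line \<open>j\<close> is not reached, and not before \<open>t + 1 = j\<close>.\<close>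

lemma hilbert_value_diff:
  "int (hilbert_value 0 t) - (if t = 0 then 0 else int (hilbert_value 0 (t - 1)))
    = int (card {j\<in>{1..\<alpha>}. j \<le> t + 1 \<and> t + 2 \<le> line_degree A j + j})"
proof -
  let ?J = "{1..\<alpha>}"
  have J: "{0<..\<alpha>} = ?J" by auto
  have "int (hilbert_value 0 t) = (\<Sum>j\<in>?J. int (min (t + 2 - j) (line_degree A j)))"
    by (simp add: hilbert_value_def J)
  moreover have "(if t = 0 then 0 else int (hilbert_value 0 (t - 1)))
      = (\<Sum>j\<in>?J. int (min (t + 1 - j) (line_degree A j)))"
    by (cases t) (simp_all add: hilbert_value_def J)
  ultimately have "int (hilbert_value 0 t) - (if t = 0 then 0 else int (hilbert_value 0 (t - 1)))
     = (\<Sum>j\<in>?J. int (min (t + 2 - j) (line_degree A j)) - int (min (t + 1 - j) (line_degree A j)))"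
    by (simp add: sum_subtractf)
  also have "\<dots> = (\<Sum>j\<in>?J. of_bool (j \<le> t + 1 \<and> t + 2 \<le> line_degree A j + j))"
    by (intro sum.cong refl) (auto simp: of_bool_def)
  also have "\<dots> = int (card {j\<in>?J. j \<le> t + 1 \<and> t + 2 \<le> line_degree A j + j})"
    by (simp add: of_bool_def sum.If_cases Int_def)
  finally show ?thesis .
qed

end

section \<open>Conjugates of valid Hilbert functions\<close>

text \<open>The initial segment \<open>1, \<dots>, \<alpha>\<close> puts the left end of the level set at \<open>j - 1\<close>; there are no gaps
  since \<open>h\<close> does not increase afterwards.\<close>

lemma level_set_interval:
  assumes valid: "valid_hilbert_fun h \<alpha>" and j: "1 \<le> j" "j \<le> \<alpha>"
  shows "{t. t < length h \<and> j \<le> h ! t} = {j - 1..<j - 1 + conjugate h j}"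
proof -
  let ?S = "{t. t < length h \<and> j \<le> h ! t}"
  have len: "\<alpha> \<le> length h" and low: "\<And>t. t < \<alpha> \<Longrightarrow> h ! t = t + 1"
    and mono: "\<And>s t. \<alpha> \<le> s \<Longrightarrow> s \<le> t \<Longrightarrow> t < length h \<Longrightarrow> h ! t \<le> h ! s"
    using valid unfolding valid_hilbert_fun_def by auto
  have mem: "j - 1 \<in> ?S" using low[of "j - 1"] j len by simp
  have ge: "j - 1 \<le> t" if "t \<in> ?S" for t
    using that low[of t] j by (cases "t < \<alpha>") auto
  have down: "s \<in> ?S" if "t \<in> ?S" "j - 1 \<le> s" "s \<le> t" for s t
    using that low[of s] mono[of s t] by (cases "s < \<alpha>") auto
  have fin: "finite ?S" by simp
  have "?S = {j - 1..<Suc (Max ?S)}"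
  proof (intro equalityI subsetI)
    fix t assume "t \<in> ?S"
    then show "t \<in> {j - 1..<Suc (Max ?S)}" using ge Max_ge[OF fin] by (simp add: less_Suc_eq_le)
  next
    fix t assume "t \<in> {j - 1..<Suc (Max ?S)}"
    moreover have "Max ?S \<in> ?S" using mem by (intro Max_in fin) blast
    ultimately show "t \<in> ?S" using down[of "Max ?S" t] by auto
  qed
  moreover from this have "card ?S = Suc (Max ?S) - (j - 1)" by (metis card_atLeastLessThan)
  moreover have "j - 1 \<le> Max ?S" by (rule Max_ge[OF fin mem])
  ultimately show ?thesis unfolding conjugate_def by simp
qed

text \<open>Position \<open>j - 1\<close>, where \<open>h\<close> takes the value \<open>j\<close>, is counted for \<open>j\<close> but not for \<open>j + 1\<close>.\<close>

lemma conjugate_strict_decreasing: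
  assumes valid: "valid_hilbert_fun h \<alpha>" and j: "1 \<le> j" "j < \<alpha>"
  shows "conjugate h (Suc j) < conjugate h j"
proof -
  have "h ! (j - 1) = j" "j - 1 < length h"
    using valid j unfolding valid_hilbert_fun_def by auto
  then have "{t. t < length h \<and> Suc j \<le> h ! t} \<subset> {t. t < length h \<and> j \<le> h ! t}"
    by (intro psubsetI) (auto intro!: exI[of _ "j - 1"] dest: equalityD2 simp: set_eq_iff)
  then show ?thesis unfolding conjugate_def by (intro psubset_card_mono) auto
qed

section \<open>Double points with a given Hilbert function\<close>

theorem theorem3p11:
  fixes h :: "nat list" and \<alpha> :: nat
  assumes "valid_hilbert_fun h \<alpha>"
    and "2 \<le> \<alpha>"
    and "\<And>i. 1 \<le> i \<Longrightarrow> i \<le> \<alpha> - 1 \<Longrightarrow>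
      real_of_int (max (int (conjugate h i) - (int i - 1)) 0) / 2 =
      real (card {k. i + 1 \<le> k \<and> k \<le> \<alpha> \<and> i \<le> conjugate h k})"
  shows "\<exists>Z :: (('k :: {alg_closed_field, field_char_0}) ^ 3) set multiset.
      is_fat_points Z \<and> all_double Z \<and>
      (\<forall>i. diff_hilbert_fun Z i = (if i < length h then int (h ! i) else 0))"
proof -
  define d where "d = conjugate h"
  define A where "A = {(j, k). 1 \<le> j \<and> j < k \<and> k \<le> \<alpha> \<and> j \<le> d k}"
  interpret node_pairs \<alpha> A by unfold_locales (auto simp: A_def)
  have d_dec: "d (Suc j) < d j" if "1 \<le> j" "j < \<alpha>" for j
    unfolding d_def by (rule conjugate_strict_decreasing[OF assms(1) that])
  have upper: "2 * card {k. (i, k) \<in> A} = d i - (i - 1)" if i: "1 \<le> i" "i \<le> \<alpha> - 1" for i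
  proof -
    have "{k. (i, k) \<in> A} = {k. i + 1 \<le> k \<and> k \<le> \<alpha> \<and> i \<le> conjugate h k}"
      using i by (auto simp: A_def d_def)
    then have "real (2 * card {k. (i, k) \<in> A}) = real_of_int (max (int (d i) - (int i - 1)) 0)"
      using assms(3)[OF i] by (simp add: d_def)
    also have "\<dots> = real (d i - (i - 1))" using i by (auto simp: max_def of_nat_diff)
    finally show ?thesis by (simp only: of_nat_eq_iff)
  qed
  \<comment> \<open>Only \<open>k = \<alpha>\<close> can contribute to the count for \<open>i = \<alpha> - 1\<close>.\<close>
  have d_last: "d \<alpha> \<le> \<alpha> - 1"
  proof -
    have "{k. (\<alpha> - 1, k) \<in> A} \<subseteq> {\<alpha>}" by (auto simp: A_def)
    then have "card {k. (\<alpha> - 1, k) \<in> A} \<le> 1" using card_mono[of "{\<alpha>}"] by simp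
    then have "d (\<alpha> - 1) - (\<alpha> - 1 - 1) \<le> 2" using upper[of "\<alpha> - 1"] assms(2) by linarith
    moreover have "d \<alpha> < d (\<alpha> - 1)" using d_dec[of "\<alpha> - 1"] assms(2) by simp
    ultimately show ?thesis using assms(2) by linarith
  qed
  have line_degree: "line_degree A i = d i" if i: "1 \<le> i" "i \<le> \<alpha>" for i
  proof -
    have "{j. (j, i) \<in> A} = {1..min (i - 1) (d i)}" using i by (auto simp: A_def)
    then have lower: "card {j. (j, i) \<in> A} = min (i - 1) (d i)" by simp
    show ?thesis
    proof (cases "i = \<alpha>")
      case True
      then have "{k. (i, k) \<in> A} = {}" by (auto simp: A_def)
      then show ?thesis using lower d_last True by (simp add: line_degree_def)
    next
      case False
      then show ?thesis using lower upper[of i] i by (simp add: line_degree_def)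
    qed
  qed
  have "A \<noteq> {}"
  proof
    assume "A = {}"
    then have "line_degree A 1 = 0" by (simp add: line_degree_def)
    then show False using line_degree[of 1] d_dec[of 1] assms(2) by simp
  qed
  then have H: "hilbert_fun (double_points (nodes :: ('k ^ 3) set)) t = hilbert_value 0 t" for t
    using hilbert_fun_double_points line_degree d_dec by simp
  have "diff_hilbert_fun (double_points (nodes :: ('k ^ 3) set)) t = (if t < length h then int (h ! t) else 0)" for t
  proof -
    have "diff_hilbert_fun (double_points (nodes :: ('k ^ 3) set)) t
        = int (card {j\<in>{1..\<alpha>}. j \<le> t + 1 \<and> t + 2 \<le> line_degree A j + j})"
      unfolding diff_hilbert_fun_def H hilbert_value_diff ..
    also have "{j\<in>{1..\<alpha>}. j \<le> t + 1 \<and> t + 2 \<le> line_degree A j + j} = {j\<in>{1..\<alpha>}. t < length h \<and> j \<le> h ! t}"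
    proof -
      have "j \<le> t + 1 \<and> t + 2 \<le> line_degree A j + j \<longleftrightarrow> t < length h \<and> j \<le> h ! t" if "j \<in> {1..\<alpha>}" for j
      proof -
        have j: "1 \<le> j" "j \<le> \<alpha>" using that by auto
        have "t < length h \<and> j \<le> h ! t \<longleftrightarrow> t \<in> {j - 1..<j - 1 + d j}"
          unfolding d_def level_set_interval[OF assms(1) j, symmetric] by simp
        also have "\<dots> \<longleftrightarrow> j - 1 \<le> t \<and> t < j - 1 + d j" by simp
        also have "\<dots> \<longleftrightarrow> j \<le> t + 1 \<and> t + 2 \<le> d j + j" using j(1) by linarith
        finally show ?thesis unfolding line_degree[OF j] by (rule sym)
      qed
      then show ?thesis by blast
    qed
    also have "int (card \<dots>) = (if t < length h then int (h ! t) else 0)"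
    proof (cases "t < length h")
      case True
      have "h ! t \<le> \<alpha>"
        using assms(1) True unfolding valid_hilbert_fun_def by (cases "t < \<alpha>") auto
      then have "{j\<in>{1..\<alpha>}. t < length h \<and> j \<le> h ! t} = {1..h ! t}" using True by auto
      then show ?thesis using True by simp
    qed simp
    finally show ?thesis .
  qed
  then show ?thesis using double_points_nodes by blast
qed

end
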